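(* With probability one there exists $n_0$ such that for every $n\ge n_0$ the function $\mathbb R^2\ni(\alpha',\theta')\mapsto Q_n(\mathbf Y_n;\alpha',\theta')$ has a unique global minimizer $(\tilde\alpha_n,\tilde\theta_n)$, given by $$\tilde\alpha_n=\frac{\sum_{k=1,k\neq s}^n(Y_k-\mu_\varepsilon)Y_{k-1}}{\sum_{k=1,k\neq s}^nY_{k-1}^2},\qquad \tilde\theta_n=Y_s-\tilde\alpha_nY_{s-1}-\mu_\varepsilon .$$ Moreover, for every $(\alpha,\theta)\in(0,1)\times\mathbb N$, almost surely $\tilde\alpha_n\to\alpha$ and $\tilde\theta_n\to Y_s-\alpha Y_{s-1}-\mu_\varepsilon$.
   Context: INAR(1) with an innovational outlier: Let $\alpha\in(0,1)$. Let $(\varepsilon_k)_{k\in\mathbb N}$ be i.i.d. non-negative integer-valued random variables with $\mathbb E\varepsilon_1^2<\infty$ and $\mathbb P(\varepsilon_1\ne 0)>0$; write $\mu_\varepsilon=\mathbb E\varepsilon_1$ (assumed known). For each $k\in\mathbb N$ let $(\xi_{k,j})_{j\in\mathbb N}$ be i.i.d. Bernoulli random variables with mean $\alpha$, these sequences being mutually independent and independent of $(\varepsilon_k)$. Fix a known time $s\in\mathbb N$ and size $\theta\in\mathbb N$. Let $Y_0$ be a non-negative integer-valued random variable with $\mathbb E Y_0^2<\infty$, independent of all $\xi_{k,j},\varepsilon_k$, and set $Y_k=\sum_{j=1}^{Y_{k-1}}\xi_{k,j}+\varepsilon_k+\delta_{k,s}\theta$, $k\in\mathbb N$. Write $\mathbf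 Y_n=(Y_0,\dots,Y_n)$, $\mathbf y_n=(y_0,\dots,y_n)$. For $n\ge s$, $$Q_n(\mathbf y_n;\alpha',\theta')=\sum_{\substack{k=1\\k\neq s}}^n(y_k-\alpha'y_{k-1}-\mu_\varepsilon)^2+(y_s-\alpha'y_{s-1}-\mu_\varepsilon-\theta')^2 .$$ *)

theory Defs
  imports "HOL-Probability.Probability"
begin

text \<open>Index set of the primitive random variables: Y_0, eps_k, xi_{k,j}.\<close>
datatype inar_idx = IY0 | IEps nat | IXi nat nat

text \<open>The INAR(1) process with an innovational outlier of size theta at time s,
  built from the primitive variables Z.\<close>
fun inarY :: "(inar_idx \<Rightarrow> 'a \<Rightarrow> nat) \<Rightarrow> nat \<Rightarrow> nat \<Rightarrow> nat \<Rightarrow> 'a \<Rightarrow> nat" where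
  "inarY Z s \<theta> 0 \<omega> = Z IY0 \<omega>"
| "inarY Z s \<theta> (Suc k) \<omega> =
     (\<Sum>j\<in>{1..inarY Z s \<theta> k \<omega>}. Z (IXi (Suc k) j) \<omega>) + Z (IEps (Suc k)) \<omega>
     + (if Suc k = s then \<theta> else 0)"

definition Qn :: "real \<Rightarrow> nat \<Rightarrow> nat \<Rightarrow> (nat \<Rightarrow> real) \<Rightarrow> real \<Rightarrow> real \<Rightarrow> real" where
  "Qn \<mu> s n y a t =
     (\<Sum>k\<in>{1..n} - {s}. (y k - a * y (k - 1) - \<mu>)\<^sup>2) + (y s - a * y (s - 1) - \<mu> - t)\<^sup>2"

definition alpha_tilde :: "real \<Rightarrow> nat \<Rightarrow> nat \<Rightarrow> (nat \<Rightarrow> real) \<Rightarrow> real" where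
  "alpha_tilde \<mu> s n y =
     (\<Sum>k\<in>{1..n} - {s}. (y k - \<mu>) * y (k - 1)) / (\<Sum>k\<in>{1..n} - {s}. (y (k - 1))\<^sup>2)"

definition theta_tilde :: "real \<Rightarrow> nat \<Rightarrow> nat \<Rightarrow> (nat \<Rightarrow> real) \<Rightarrow> real" where
  "theta_tilde \<mu> s n y = y s - alpha_tilde \<mu> s n y * y (s - 1) - \<mu>"

end

theory Submission
  imports Defs
begin

text \<open>Away from the outlier, the regression noise $e_k = Y_{k+1} - \alpha Y_k - \mu$ is a martingale difference
  with conditional variance $\alpha(1-\alpha) Y_k + \sigma^2$. With $D_k = 1 + \sum_{i \le k} Y_i^2$, the weighted
  differences $Y_k e_k / D_k$ have second moments bounded by a multiple of
  $\mathbb{E}(Y_k^2 / D_k^{3/2})$ because $Y_k \le \sqrt{D_k}$, and $\sum_k Y_k^2 / D_k^{3/2} \le 2$ pathwise.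
  Hence $\sum_k Y_k e_k / D_k$ converges almost surely. Infinitely many innovations are nonzero, so
  $D_k \to \infty$, and Kronecker's lemma gives $\sum_{i \le k} Y_i e_i / D_k \to 0$, which is the consistency of the
  estimator. Neither stationarity nor ergodicity is needed.\<close>

section \<open>Square-integrable martingale differences\<close>

text \<open>Normalizing by the observed \<open>D k\<close> makes the weight of each noise term known
  before that term is drawn: \<open>D k\<close> involves only values up to time \<open>k\<close>,
  yet already contains the current regressor. The exponent 3/2 is what remains of
  \<open>Y^2 * Y / D^2\<close> once one factor \<open>Y\<close> is traded for \<open>sqrt D\<close>;
  any exponent above 1 would give a convergent series of Abel-Dini type, so the trade leaves room.
  The filtration is generated by the observed path alone. Its histories take countably many values,
  so a conditional expectation reduces to integrals over atoms on which the number of thinning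
  variables is a constant. The outlier enters one transition only, which is left out of the
  regression for \<open>\<alpha>\<close>; later transitions start from a shifted value but obey the
  same noise equation. A single observation carries the size of the outlier, so the limit of its
  estimator keeps the noise of that transition.\<close>

lemma integrable_mult_of_square_integrable:
  fixes f g :: "'a \<Rightarrow> real"
  assumes [measurable]: "f \<in> borel_measurable M" "g \<in> borel_measurable M"
    and "integrable M (\<lambda>x. (f x)\<^sup>2)" "integrable M (\<lambda>x. (g x)\<^sup>2)"
  shows "integrable M (\<lambda>x. f x * g x)"
proof (rule Bochner_Integration.integrable_bound)
  show "integrable M (\<lambda>x. (f x)\<^sup>2 + (g x)\<^sup>2)"
    using assms by simp
  have "\<bar>u * v\<bar> \<le> u\<^sup>2 + v\<^sup>2" for u v :: real
  proof -
    have "0 \<le> (\<bar>u\<bar> - \<bar>v\<bar>)\<^sup>2" by simp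
    then have "2 * \<bar>u * v\<bar> \<le> u\<^sup>2 + v\<^sup>2" by (simp add: power2_diff abs_mult)
    then show ?thesis by linarith
  qed
  then show "AE x in M. norm (f x * g x) \<le> norm ((f x)\<^sup>2 + (g x)\<^sup>2)"
    by (intro AE_I2) (simp add: abs_of_nonneg)
qed measurable

lemma integrable_power2_add:
  fixes f g :: "'a \<Rightarrow> real"
  assumes "f \<in> borel_measurable M" "g \<in> borel_measurable M"
    and "integrable M (\<lambda>x. (f x)\<^sup>2)" "integrable M (\<lambda>x. (g x)\<^sup>2)"
  shows "integrable M (\<lambda>x. (f x + g x)\<^sup>2)"
  using assms integrable_mult_of_square_integrable[OF assms]
  by (simp add: power2_sum mult.assoc)

text \<open>The index of \<open>X n\<close> is that of the conditioning time: \<open>X n\<close> is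
  centred given \<open>F n\<close> and known at \<open>Suc n\<close>. A weight measurable in
  \<open>F n\<close> is therefore predictable.\<close>

locale square_integrable_martingale_diff = prob_space M for M :: "'a measure" +
  fixes F :: "nat \<Rightarrow> 'a measure" and X :: "nat \<Rightarrow> 'a \<Rightarrow> real"
  assumes subalgebra_F: "subalgebra M (F n)"
    and subalgebra_F_mono: "m \<le> n \<Longrightarrow> subalgebra (F n) (F m)"
    and adapted: "X n \<in> borel_measurable (F (Suc n))"
    and square_integrable: "integrable M (\<lambda>\<omega>. (X n \<omega>)\<^sup>2)"
    and cond_exp_0: "AE \<omega> in M. real_cond_exp M (F n) (X n) \<omega> = 0"
begin

lemma borel_measurable_X [measurable]: "X n \<in> borel_measurable M"
  using adapted measurable_from_subalg[OF subalgebra_F] by blast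

lemma adapted_mono: "i < n \<Longrightarrow> X i \<in> borel_measurable (F n)"
  using measurable_from_subalg[OF subalgebra_F_mono[of "Suc i" n] adapted[of i]] by simp

text \<open>The factor \<open>g\<close> passes through the conditional expectation. Only the product
  has to be integrable, because \<open>g\<close> will contain an unbounded partial sum.\<close>

lemma integral_predictable_mult_eq_0:
  assumes g: "g \<in> borel_measurable (F n)" and int: "integrable M (\<lambda>\<omega>. g \<omega> * X n \<omega>)"
  shows "(\<integral>\<omega>. g \<omega> * X n \<omega> \<partial>M) = 0"
proof -
  interpret finite_measure_subalgebra M "F n"
    by unfold_locales (rule subalgebra_F)
  have "(\<integral>\<omega>. g \<omega> * X n \<omega> \<partial>M) = (\<integral>\<omega>. g \<omega> * real_cond_exp M (F n) (X n) \<omega> \<partial>M)"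
    using real_cond_exp_intg(2)[OF int g] by simp
  also have "\<dots> = (\<integral>\<omega>. 0 \<partial>M)"
    using cond_exp_0[of n] measurable_from_subalg[OF subalgebra_F g]
    by (intro integral_cong_AE) auto
  finally show ?thesis by simp
qed

text \<open>Predictable weights preserve orthogonality, so second moments add up. The weights are
  kept general so that stopping can be expressed as multiplication by an indicator.\<close>

lemma
  assumes g: "\<And>i. g i \<in> borel_measurable (F i)" and g_le: "\<And>i \<omega>. \<bar>g i \<omega>\<bar> \<le> 1"
  shows integrable_transform_square: "integrable M (\<lambda>\<omega>. (\<Sum>i<n. g i \<omega> * X i \<omega>)\<^sup>2)" (is "?I n")
    and integral_transform_square:
      "(\<integral>\<omega>. (\<Sum>i<n. g i \<omega> * X i \<omega>)\<^sup>2 \<partial>M) = (\<Sum>i<n. \<integral>\<omega>. (g i \<omega> * X i \<omega>)\<^sup>2 \<partial>M)" (is "?E n")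
proof -
  have [measurable]: "g i \<in> borel_measurable M" for i
    using g measurable_from_subalg[OF subalgebra_F] by blast
  have g_sq: "(g i \<omega>)\<^sup>2 \<le> 1" for i \<omega>
    using g_le abs_square_le_1 by blast
  have sq: "integrable M (\<lambda>\<omega>. (g i \<omega> * X i \<omega>)\<^sup>2)" for i
    by (rule Bochner_Integration.integrable_bound[OF square_integrable[of i]])
       (use g_sq in \<open>auto simp: power_mult_distrib intro!: AE_I2 mult_left_le_one_le\<close>)
  have "?I n \<and> ?E n"
  proof (induction n)
    case (Suc n)
    let ?S = "\<lambda>\<omega>. \<Sum>i<n. g i \<omega> * X i \<omega>"
    have int: "integrable M (\<lambda>\<omega>. ?S \<omega> * (g n \<omega> * X n \<omega>))"
      by (rule integrable_mult_of_square_integrable) (use Suc sq in auto)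
    \<comment> \<open>In the cross term the weight \<open>g n\<close> is grouped with the past sum
      \<open>?S\<close>; all of \<open>?S * g n\<close> is then known at time \<open>n\<close>, and
      only \<open>X n\<close> is left to be averaged out.\<close>
    have "g i \<in> borel_measurable (F n)" if "i < n" for i
      using measurable_from_subalg[OF subalgebra_F_mono[of i n] g[of i]] that by simp
    then have "(\<lambda>\<omega>. ?S \<omega> * g n \<omega>) \<in> borel_measurable (F n)"
      using g adapted_mono by (intro borel_measurable_times borel_measurable_sum) auto
    from integral_predictable_mult_eq_0[OF this]
    have cross: "(\<integral>\<omega>. ?S \<omega> * (g n \<omega> * X n \<omega>) \<partial>M) = 0"
      using int by (simp add: mult.assoc)
    have eq: "(\<Sum>i<Suc n. g i \<omega> * X i \<omega>)\<^sup>2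
        = (?S \<omega>)\<^sup>2 + (g n \<omega> * X n \<omega>)\<^sup>2 + 2 * (?S \<omega> * (g n \<omega> * X n \<omega>))" for \<omega>
      by (simp add: power2_sum)
    show ?case
      unfolding eq using Suc sq int cross by simp
  qed simp
  then show "?I n" "?E n" by auto
qed

text \<open>Kolmogorov's maximal inequality: stop the partial sums when they first leave $(-c,c)$.\<close>

lemma maximal_inequality:
  assumes c: "0 < c"
  shows "prob {\<omega>\<in>space M. \<exists>j\<le>n. c \<le> \<bar>\<Sum>i<j. X i \<omega>\<bar>} \<le> (\<Sum>i<n. \<integral>\<omega>. (X i \<omega>)\<^sup>2 \<partial>M) / c\<^sup>2"
proof -
  \<comment> \<open>\<open>g i\<close> inspects sums of at most \<open>i\<close> terms, hence only
    \<open>X r\<close> with \<open>r < i\<close>, and is predictable. It is still 1 for the term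
    that carries the sum across the level, so the stopped sum ends at a value of modulus at least
    \<open>c\<close>.\<close>
  define g :: "nat \<Rightarrow> 'a \<Rightarrow> real"
    where "g i \<omega> = of_bool (\<forall>l\<in>{..i}. \<bar>\<Sum>r<l. X r \<omega>\<bar> < c)" for i \<omega>
  have g: "g i \<in> borel_measurable (F i)" for i
  proof -
    have [measurable]: "(\<lambda>\<omega>. \<Sum>r<l. X r \<omega>) \<in> borel_measurable (F i)" if "l \<in> {..i}" for l
      using that by (intro borel_measurable_sum adapted_mono) auto
    show ?thesis
      unfolding g_def of_bool_def by measurable
  qed
  have g_le: "\<bar>g i \<omega>\<bar> \<le> 1" for i \<omega>
    by (simp add: g_def)
  have [measurable]: "g i \<in> borel_measurable M" for i
    using g measurable_from_subalg[OF subalgebra_F] by blast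
  let ?T = "\<lambda>\<omega>. \<Sum>i<n. g i \<omega> * X i \<omega>"
  note int_T = integrable_transform_square[of g n, OF g g_le]
  have "c\<^sup>2 \<le> (?T \<omega>)\<^sup>2" if "\<exists>j\<le>n. c \<le> \<bar>\<Sum>i<j. X i \<omega>\<bar>" for \<omega>
  proof -
    define l where "l = (LEAST j. c \<le> \<bar>\<Sum>i<j. X i \<omega>\<bar>)"
    have l: "c \<le> \<bar>\<Sum>i<l. X i \<omega>\<bar>" "l \<le> n"
      using that unfolding l_def by (auto intro: LeastI Least_le order_trans)
    have small: "\<bar>\<Sum>i<j. X i \<omega>\<bar> < c" if "j < l" for j
      using not_less_Least[OF that[unfolded l_def]] by simp
    have "?T \<omega> = (\<Sum>i<n. if i < l then X i \<omega> else 0)"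
      using l(1) small by (intro sum.cong) (auto simp: g_def not_less not_le)
    also have "\<dots> = (\<Sum>i<l. X i \<omega>)"
      using l(2) by (intro sum.mono_neutral_cong_right) auto
    finally show ?thesis
      using l(1) c by (metis abs_le_square_iff abs_of_pos)
  qed
  then have "prob {\<omega>\<in>space M. \<exists>j\<le>n. c \<le> \<bar>\<Sum>i<j. X i \<omega>\<bar>} \<le> prob {\<omega>\<in>space M. c\<^sup>2 \<le> (?T \<omega>)\<^sup>2}"
    by (intro finite_measure_mono) auto
  also have "\<dots> \<le> (\<integral>\<omega>. (?T \<omega>)\<^sup>2 \<partial>M) / c\<^sup>2"
    using c int_T by (intro integral_Markov_inequality_measure[where A="{}"]) auto
  also have "\<dots> \<le> (\<Sum>i<n. \<integral>\<omega>. (X i \<omega>)\<^sup>2 \<partial>M) / c\<^sup>2"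
    unfolding integral_transform_square[of g n, OF g g_le]
    by (intro divide_right_mono sum_mono integral_mono' square_integrable)
       (auto simp: g_def)
  finally show ?thesis .
qed

lemma shift: "square_integrable_martingale_diff M (\<lambda>n. F (m + n)) (\<lambda>n. X (m + n))"
  by unfold_locales
     (use subalgebra_F subalgebra_F_mono adapted square_integrable cond_exp_0 in auto)

text \<open>For every finite horizon the bound is at most the full tail of the variance series, so
  it survives continuity from below along the increasing events \<open>?A n\<close>.\<close>

lemma maximal_inequality_tail:
  assumes c: "0 < c" and summable: "summable (\<lambda>n. \<integral>\<omega>. (X n \<omega>)\<^sup>2 \<partial>M)"
  shows "prob {\<omega>\<in>space M. \<exists>j. c \<le> \<bar>\<Sum>i<j. X (m + i) \<omega>\<bar>}
      \<le> (\<Sum>i. \<integral>\<omega>. (X (m + i) \<omega>)\<^sup>2 \<partial>M) / c\<^sup>2"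
proof -
  interpret shifted: square_integrable_martingale_diff M "\<lambda>n. F (m + n)" "\<lambda>n. X (m + n)"
    by (rule shift)
  let ?A = "\<lambda>n. {\<omega>\<in>space M. \<exists>j\<le>n. c \<le> \<bar>\<Sum>i<j. X (m + i) \<omega>\<bar>}"
  have "(\<lambda>n. prob (?A n)) \<longlonglongrightarrow> prob (\<Union>n. ?A n)"
    by (intro finite_Lim_measure_incseq) (auto simp: incseq_def intro: order_trans)
  moreover have "prob (?A n) \<le> (\<Sum>i. \<integral>\<omega>. (X (m + i) \<omega>)\<^sup>2 \<partial>M) / c\<^sup>2" for n
  proof -
    have "(\<Sum>i<n. \<integral>\<omega>. (X (m + i) \<omega>)\<^sup>2 \<partial>M) \<le> (\<Sum>i. \<integral>\<omega>. (X (m + i) \<omega>)\<^sup>2 \<partial>M)"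
      using summable summable_ignore_initial_segment[OF summable, of m]
      by (intro sum_le_suminf) (auto simp: add.commute)
    then show ?thesis
      using shifted.maximal_inequality[OF c, of n] c
      by (meson divide_right_mono order_trans zero_le_power2)
  qed
  ultimately have "prob (\<Union>n. ?A n) \<le> (\<Sum>i. \<integral>\<omega>. (X (m + i) \<omega>)\<^sup>2 \<partial>M) / c\<^sup>2"
    by (intro LIMSEQ_le_const2) auto
  also have "(\<Union>n. ?A n) = {\<omega>\<in>space M. \<exists>j. c \<le> \<bar>\<Sum>i<j. X (m + i) \<omega>\<bar>}"
    by auto
  finally show ?thesis .
qed

text \<open>The tails of the variance series vanish, so for each fixed level the event that the sums
  started at \<open>m\<close> reach it for every \<open>m\<close> is null. Letting the level run
  through the countably many values \<open>1 / (r + 1)\<close> gives the Cauchy property.\<close>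

theorem AE_summable:
  assumes summable: "summable (\<lambda>n. \<integral>\<omega>. (X n \<omega>)\<^sup>2 \<partial>M)"
  shows "AE \<omega> in M. summable (\<lambda>n. X n \<omega>)"
proof -
  have "AE \<omega> in M. \<exists>m. \<forall>j. \<bar>\<Sum>i<j. X (m + i) \<omega>\<bar> < inverse (real (Suc r))" for r
  proof -
    define c where "c = inverse (real (Suc r))"
    have c: "0 < c" by (simp add: c_def)
    let ?B = "\<lambda>m. {\<omega>\<in>space M. \<exists>j. c \<le> \<bar>\<Sum>i<j. X (m + i) \<omega>\<bar>}"
    have "(\<lambda>m. \<Sum>i. \<integral>\<omega>. (X (i + m) \<omega>)\<^sup>2 \<partial>M) \<longlonglongrightarrow> 0"
      using suminf_exist_split2[OF summable] by simp
    then have "(\<lambda>m. (\<Sum>i. \<integral>\<omega>. (X (m + i) \<omega>)\<^sup>2 \<partial>M) / c\<^sup>2) \<longlonglongrightarrow> 0 / c\<^sup>2"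
      using c by (intro tendsto_divide) (auto simp: add.commute)
    moreover have "prob (\<Inter>m. ?B m) \<le> (\<Sum>i. \<integral>\<omega>. (X (m + i) \<omega>)\<^sup>2 \<partial>M) / c\<^sup>2" for m
      by (rule order_trans[OF _ maximal_inequality_tail[OF c summable]])
         (auto intro!: finite_measure_mono)
    ultimately have "prob (\<Inter>m. ?B m) \<le> 0"
      by (intro LIMSEQ_le_const) auto
    then have "prob (\<Inter>m. ?B m) = 0"
      using measure_nonneg[of M "\<Inter>m. ?B m"] by linarith
    then have "AE \<omega> in M. \<omega> \<notin> (\<Inter>m. ?B m)"
      by (subst (asm) prob_eq_0) auto
    then show ?thesis
      using AE_space by eventually_elim (auto simp: c_def not_le)
  qed
  then have "AE \<omega> in M. \<forall>r. \<exists>m. \<forall>j. \<bar>\<Sum>i<j. X (m + i) \<omega>\<bar> < inverse (real (Suc r))"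
    by (simp add: AE_all_countable)
  then show ?thesis
  proof eventually_elim
    case (elim \<omega>)
    show ?case
      unfolding summable_Cauchy
    proof (intro allI impI)
      fix e :: real assume "0 < e"
      then obtain r where r: "inverse (real (Suc r)) < e / 2"
        using reals_Archimedean[of "e / 2"] by auto
      obtain m where m: "\<And>j. \<bar>\<Sum>i<j. X (m + i) \<omega>\<bar> < inverse (real (Suc r))"
        using elim by blast
      \<comment> \<open>A block starting later than \<open>m\<close> is a difference of two blocks
        starting at \<open>m\<close>, which is why each gets half of \<open>e\<close>.\<close>
      have m': "\<bar>\<Sum>i\<in>{m..<n}. X i \<omega>\<bar> < e / 2" for n
        using m[of "n - m"] r sum.shift_bounds_nat_ivl[of "\<lambda>i. X i \<omega>" 0 m "n - m"] \<open>0 < e\<close>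
        by (cases "m \<le> n") (auto simp: add.commute atLeast0LessThan)
      have "norm (\<Sum>i\<in>{k..<n}. X i \<omega>) < e" if "m \<le> k" for k n
      proof (cases "k \<le> n")
        case True
        then have "(\<Sum>i\<in>{k..<n}. X i \<omega>) = (\<Sum>i\<in>{m..<n}. X i \<omega>) - (\<Sum>i\<in>{m..<k}. X i \<omega>)"
          using that sum.atLeastLessThan_concat[of m k n "\<lambda>i. X i \<omega>"] by simp
        then show ?thesis
          using m'[of n] m'[of k] by simp
      qed (use \<open>0 < e\<close> in simp)
      then show "\<exists>N. \<forall>k\<ge>N. \<forall>n. norm (\<Sum>i\<in>{k..<n}. X i \<omega>) < e" by blast
    qed
  qed
qed

end

section \<open>Sums of independent centred variables, and conditioning on a countably valued
  variable\<close>

lemma (in prob_space)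
  fixes W :: "'i \<Rightarrow> 'a \<Rightarrow> real"
  assumes "finite I" "indep_vars (\<lambda>_. borel) W I"
    and "\<And>i. i \<in> I \<Longrightarrow> integrable M (\<lambda>\<omega>. (W i \<omega>)\<^sup>2)" "\<And>i. i \<in> I \<Longrightarrow> expectation (W i) = 0"
  shows integrable_indep_sum_square: "integrable M (\<lambda>\<omega>. (\<Sum>i\<in>I. W i \<omega>)\<^sup>2)"
    and expectation_indep_sum_square:
      "expectation (\<lambda>\<omega>. (\<Sum>i\<in>I. W i \<omega>)\<^sup>2) = (\<Sum>i\<in>I. expectation (\<lambda>\<omega>. (W i \<omega>)\<^sup>2))"
proof -
  have "integrable M (\<lambda>\<omega>. (\<Sum>i\<in>I. W i \<omega>)\<^sup>2)
    \<and> expectation (\<lambda>\<omega>. (\<Sum>i\<in>I. W i \<omega>)\<^sup>2) = (\<Sum>i\<in>I. expectation (\<lambda>\<omega>. (W i \<omega>)\<^sup>2))"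
    using assms
  proof (induction I rule: finite_induct)
    case (insert i I)
    have W [measurable]: "W j \<in> borel_measurable M" if "j \<in> insert i I" for j
      using insert.prems(1) that by (auto simp: indep_vars_def)
    have int: "integrable M (W j)" if "j \<in> insert i I" for j
      using square_integrable_imp_integrable[OF W insert.prems(2)] that by blast
    have IH: "integrable M (\<lambda>\<omega>. (\<Sum>i\<in>I. W i \<omega>)\<^sup>2)"
      "expectation (\<lambda>\<omega>. (\<Sum>i\<in>I. W i \<omega>)\<^sup>2) = (\<Sum>i\<in>I. expectation (\<lambda>\<omega>. (W i \<omega>)\<^sup>2))"
      using insert.IH insert.prems indep_vars_subset[OF insert.prems(1)] by auto
    note indep = indep_vars_sum[OF insert.hyps insert.prems(1)]
    \<comment> \<open>The new variable is independent of the sum of the others, and both are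
      centred.\<close>
    have "expectation (\<lambda>\<omega>. W i \<omega> * (\<Sum>j\<in>I. W j \<omega>)) = 0"
      using indep_var_lebesgue_integral[OF indep] int insert.prems(3) by simp
    moreover have "integrable M (\<lambda>\<omega>. W i \<omega> * (\<Sum>j\<in>I. W j \<omega>))"
      using indep_var_integrable[OF indep] int by simp
    ultimately show ?case
      using insert.hyps insert.prems(2) IH by (simp add: power2_sum mult.assoc)
  qed simp
  then show "integrable M (\<lambda>\<omega>. (\<Sum>i\<in>I. W i \<omega>)\<^sup>2)"
    "expectation (\<lambda>\<omega>. (\<Sum>i\<in>I. W i \<omega>)\<^sup>2) = (\<Sum>i\<in>I. expectation (\<lambda>\<omega>. (W i \<omega>)\<^sup>2))"
    by auto
qed

text \<open>A freezing argument: on the atom where \<open>H\<close> equals \<open>h\<close> the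
  integrand is \<open>V h\<close>, which is centred and independent of the indicator of that atom.
  Every set of the generated sigma-algebra is a countable union of atoms.\<close>

lemma (in prob_space) real_cond_exp_vimage_count_space_eq_0:
  fixes H :: "'a \<Rightarrow> 'c::countable" and V :: "'c \<Rightarrow> 'a \<Rightarrow> real"
  assumes H [measurable]: "H \<in> measurable M (count_space UNIV)"
    and indep: "\<And>h. indep_var borel (\<lambda>\<omega>. indicator {h} (H \<omega>)) borel (V h)"
    and V: "\<And>h. integrable M (V h)" "\<And>h. expectation (V h) = 0"
    and int: "integrable M (\<lambda>\<omega>. V (H \<omega>) \<omega>)"
  shows "AE \<omega> in M. real_cond_exp M (vimage_algebra (space M) H (count_space UNIV)) (\<lambda>\<omega>. V (H \<omega>) \<omega>) \<omega> = 0"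
proof -
  interpret finite_measure_subalgebra M "vimage_algebra (space M) H (count_space UNIV)"
    using H by unfold_locales (auto simp: subalgebra_def measurable_iff_sets)
  show ?thesis
  proof (rule real_cond_exp_charact[OF _ int])
    fix A assume "A \<in> sets (vimage_algebra (space M) H (count_space UNIV))"
    then obtain B where A: "A = H -` B \<inter> space M"
      by (auto simp: sets_vimage_algebra2)
    \<comment> \<open>The atoms are numbered by \<open>to_nat\<close> to obtain a sequence; a number
      that codes no element of \<open>B\<close> yields the empty set.\<close>
    define A' where "A' i = {\<omega>\<in>space M. H \<omega> \<in> B \<and> to_nat (H \<omega>) = i}" for i
    have A'_sets: "A' i \<in> sets M" for i
      unfolding A'_def by measurable
    have A_eq: "A = (\<Union>i. A' i)"
      by (auto simp: A A'_def)
    have atom: "(LINT \<omega>:A' i|M. V (H \<omega>) \<omega>) = 0" for i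
    proof (cases "\<exists>h\<in>B. to_nat h = i")
      case True
      then obtain h where h: "h \<in> B" "to_nat h = i" by blast
      have "(LINT \<omega>:A' i|M. V (H \<omega>) \<omega>) = expectation (\<lambda>\<omega>. indicator {h} (H \<omega>) * V h \<omega>)"
        unfolding set_lebesgue_integral_def
        using h by (intro Bochner_Integration.integral_cong) (auto simp: A'_def indicator_def)
      also have "\<dots> = 0"
        by (subst indep_var_lebesgue_integral[OF indep])
           (auto simp: V intro!: integrable_const_bound[where B=1])
      finally show ?thesis .
    next
      case False
      then have "A' i = {}" by (auto simp: A'_def)
      then show ?thesis by (simp add: set_lebesgue_integral_def)
    qed
    have "set_integrable M (\<Union>i. A' i) (\<lambda>\<omega>. V (H \<omega>) \<omega>)"
      unfolding set_integrable_def using A'_sets int by (intro integrable_mult_indicator) auto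
    then have "(LINT \<omega>:A|M. V (H \<omega>) \<omega>) = (\<Sum>i. LINT \<omega>:A' i|M. V (H \<omega>) \<omega>)"
      unfolding A_eq
      by (intro lebesgue_integral_countable_add A'_sets) (auto simp: A'_def)
    then show "(LINT \<omega>:A|M. V (H \<omega>) \<omega>) = (LINT \<omega>:A|M. 0)"
      by (simp add: atom)
  qed auto
qed

section \<open>Series and weighted averages\<close>

text \<open>A Toeplitz average: the nonnegative weights \<open>D (Suc k) - D k\<close> telescope, so
  late terms contribute at most \<open>e / 2\<close> times \<open>D n\<close>, and the early ones
  are a constant that \<open>D n\<close> outgrows.\<close>

lemma weighted_average_tendsto_0:
  fixes D r :: "nat \<Rightarrow> real"
  assumes D: "incseq D" "filterlim D at_top sequentially" and r: "r \<longlonglongrightarrow> 0"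
  shows "(\<lambda>n. (\<Sum>k<n. (D (Suc k) - D k) * r k) / D n) \<longlonglongrightarrow> 0"
proof (rule LIMSEQ_I)
  fix e :: real assume e: "0 < e"
  obtain N where N: "\<And>k. N \<le> k \<Longrightarrow> \<bar>r k\<bar> < e / 2"
    using LIMSEQ_D[OF r, of "e / 2"] e by auto
  \<comment> \<open>\<open>K\<close> gathers everything that does not depend on \<open>n\<close>;
    the modulus of \<open>D N\<close> covers a negative initial part of \<open>D\<close>.\<close>
  define K where "K = \<bar>\<Sum>k<N. (D (Suc k) - D k) * r k\<bar> + e / 2 * \<bar>D N\<bar>"
  have bound: "\<bar>\<Sum>k<n. (D (Suc k) - D k) * r k\<bar> \<le> K + e / 2 * D n" if "N \<le> n" for n
  proof -
    have "\<bar>\<Sum>k<n. (D (Suc k) - D k) * r k\<bar>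
        \<le> \<bar>\<Sum>k<N. (D (Suc k) - D k) * r k\<bar> + e / 2 * (D n - D N)"
      using that
    proof (induction n rule: dec_induct)
      case (step n)
      have "\<bar>(D (Suc n) - D n) * r n\<bar> \<le> (D (Suc n) - D n) * (e / 2)"
        unfolding abs_mult using N[OF step(1)] incseqD[OF D(1), of n "Suc n"]
        by (intro mult_mono) auto
      moreover have "e / 2 * (D (Suc n) - D N) = e / 2 * (D n - D N) + (D (Suc n) - D n) * (e / 2)"
        by (simp add: field_simps)
      ultimately show ?case
        using step(3) abs_triangle_ineq[of "\<Sum>k<n. (D (Suc k) - D k) * r k" "(D (Suc n) - D n) * r n"]
        by (simp only: sum.lessThan_Suc)
    qed simp
    also have "\<dots> \<le> K + e / 2 * D n"
      using mult_nonneg_nonneg[of e "2 * D N + 2 * \<bar>D N\<bar>"] e by (simp add: K_def field_simps)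
    finally show ?thesis .
  qed
  have "eventually (\<lambda>n. 2 * K / e < D n \<and> 0 < D n) sequentially"
    using D(2) by (auto simp: filterlim_at_top_dense intro: eventually_conj)
  then obtain N' where N': "\<And>n. N' \<le> n \<Longrightarrow> 2 * K / e < D n \<and> 0 < D n"
    by (auto simp: eventually_sequentially)
  have "norm ((\<Sum>k<n. (D (Suc k) - D k) * r k) / D n - 0) < e" if "max N N' \<le> n" for n
  proof -
    have "K < e / 2 * D n" "0 < D n"
      using N'[of n] that e by (auto simp: field_simps)
    then show ?thesis
      using bound[of n] that by (simp add: field_simps)
  qed
  then show "\<exists>no. \<forall>n\<ge>no. norm ((\<Sum>k<n. (D (Suc k) - D k) * r k) / D n - 0) < e"
    by blast
qed

text \<open>Summation by parts against the tails \<open>R\<close> of the series rather than its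
  partial sums: the tails tend to 0, so no limit has to be subtracted and each piece vanishes
  separately.\<close>

lemma Kronecker_lemma:
  fixes D x :: "nat \<Rightarrow> real"
  assumes D: "incseq D" "filterlim D at_top sequentially" "\<And>n. 0 < D n"
    and summable: "summable (\<lambda>k. x k / D k)"
  shows "(\<lambda>n. (\<Sum>k\<le>n. x k) / D n) \<longlonglongrightarrow> 0"
proof -
  define R where "R n = (\<Sum>k. x (k + n) / D (k + n))" for n
  have R: "R \<longlonglongrightarrow> 0"
    unfolding R_def using suminf_exist_split2[OF summable] by simp
  have x_eq: "x n = D n * (R n - R (Suc n))" for n
  proof -
    have "summable (\<lambda>k. x (k + n) / D (k + n))"
      using summable_ignore_initial_segment[OF summable] .
    from suminf_split_head[OF this] have "R (Suc n) = R n - x n / D n"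
      by (simp add: R_def)
    then show ?thesis
      using D(3)[of n] by (simp add: field_simps)
  qed
  have by_parts: "(\<Sum>k<n. x k) = D 0 * R 0 - D n * R n + (\<Sum>k<n. (D (Suc k) - D k) * R (Suc k))" for n
    by (induction n) (simp_all add: x_eq algebra_simps)
  \<comment> \<open>The final summand \<open>x n / D n\<close> is there because the claim sums up to
    and including \<open>n\<close>, while \<open>by_parts\<close> stops before
    \<open>n\<close>.\<close>
  have "(\<lambda>n. D 0 * R 0 / D n - R n + (\<Sum>k<n. (D (Suc k) - D k) * R (Suc k)) / D n + x n / D n)
      \<longlonglongrightarrow> 0 - 0 + 0 + 0"
    by (intro tendsto_add tendsto_diff R weighted_average_tendsto_0 D LIMSEQ_Suc summable_LIMSEQ_zero[OF summable]
        tendsto_divide_0[OF tendsto_const] filterlim_at_top_imp_at_infinity)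
  moreover have "(\<Sum>k\<le>n. x k) / D n = D 0 * R 0 / D n - R n
      + (\<Sum>k<n. (D (Suc k) - D k) * R (Suc k)) / D n + x n / D n" for n
    using by_parts[of n] less_imp_neq[OF D(3)[of n]]
    by (simp add: lessThan_Suc_atMost[symmetric] add_divide_distrib diff_divide_distrib)
  ultimately show ?thesis by simp
qed

text \<open>Comparison with the integral of \<open>t\<close> to the power -3/2 between consecutive
  partial sums, which equals \<open>2 / sqrt (C k) - 2 / sqrt (C (Suc k))\<close>. The bounds
  telescope from \<open>C 0 = 1\<close>, whence the constant 2.\<close>

lemma Abel_Dini_three_halves:
  fixes d :: "nat \<Rightarrow> real"
  assumes "\<And>k. 0 \<le> d k"
  shows "(\<Sum>k<n. d k / ((1 + (\<Sum>i\<le>k. d i)) * sqrt (1 + (\<Sum>i\<le>k. d i)))) \<le> 2"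
proof -
  define C where "C k = 1 + (\<Sum>i<k. d i)" for k
  have C_Suc: "C (Suc k) = C k + d k" for k
    by (simp add: C_def)
  have C: "1 \<le> C k" for k
    using assms by (simp add: C_def sum_nonneg)
  have step: "d k / (C (Suc k) * sqrt (C (Suc k))) \<le> 2 / sqrt (C k) - 2 / sqrt (C (Suc k))" for k
  proof -
    define a where "a = sqrt (C k)"
    define b where "b = sqrt (C (Suc k))"
    have ab: "1 \<le> a" "a \<le> b"
      using C[of k] assms[of k] by (auto simp: a_def b_def C_Suc)
    have b2: "C (Suc k) = b\<^sup>2" and d: "d k = b\<^sup>2 - a\<^sup>2"
      using C[of k] C[of "Suc k"] by (auto simp: a_def b_def C_Suc)
    \<comment> \<open>After clearing denominators and cancelling \<open>b - a\<close>, the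
      comparison is just \<open>a * (a + b) \<le> 2 * b^2\<close>, which follows from
      \<open>a \<le> b\<close>.\<close>
    have "(b - a) * (a * (a + b)) \<le> (b - a) * (2 * b\<^sup>2)"
      using ab mult_mono[of a b "a + b" "2 * b"]
      by (intro mult_left_mono) (auto simp: power2_eq_square mult_ac)
    then have "(b\<^sup>2 - a\<^sup>2) * a \<le> (2 * b - 2 * a) * b\<^sup>2"
      by (simp add: power2_eq_square algebra_simps)
    then have "(b\<^sup>2 - a\<^sup>2) * a / (a * b\<^sup>2 * b) \<le> (2 * b - 2 * a) * b\<^sup>2 / (a * b\<^sup>2 * b)"
      using ab by (intro divide_right_mono) auto
    moreover have "2 / a - 2 / b = (2 * b - 2 * a) * b\<^sup>2 / (a * b\<^sup>2 * b)"
      using ab by (simp add: field_simps power2_eq_square)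
    moreover have "(b\<^sup>2 - a\<^sup>2) / (b\<^sup>2 * b) = (b\<^sup>2 - a\<^sup>2) * a / (a * b\<^sup>2 * b)"
      using ab by (simp add: field_simps power2_eq_square)
    ultimately have "(b\<^sup>2 - a\<^sup>2) / (b\<^sup>2 * b) \<le> 2 / a - 2 / b"
      by (simp only:)
    then show ?thesis
      unfolding d b2 using ab by (simp add: a_def b_def)
  qed
  have "(\<Sum>k<n. d k / (C (Suc k) * sqrt (C (Suc k)))) \<le> (\<Sum>k<n. 2 / sqrt (C k) - 2 / sqrt (C (Suc k)))"
    by (intro sum_mono step)
  also have "\<dots> = 2 / sqrt (C 0) - 2 / sqrt (C n)"
    by (rule sum_lessThan_telescope')
  also have "\<dots> \<le> 2"
    using C[of n] by (simp add: C_def)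
  finally show ?thesis
    by (simp add: C_def lessThan_Suc_atMost)
qed

lemma tendsto_at_top_of_frequently_ge_1:
  fixes d :: "nat \<Rightarrow> real"
  assumes d: "\<And>k. 0 \<le> d k" and freq: "\<And>n. \<exists>k>n. 1 \<le> d k"
  shows "filterlim (\<lambda>n. 1 + (\<Sum>i\<le>n. d i)) at_top sequentially"
proof -
  have "\<exists>n. real N \<le> (\<Sum>i\<le>n. d i)" for N
  proof (induction N)
    case (Suc N)
    then obtain n where n: "real N \<le> (\<Sum>i\<le>n. d i)" by blast
    obtain k where k: "n < k" "1 \<le> d k" using freq by blast
    have "(\<Sum>i\<le>n. d i) + d k = (\<Sum>i\<in>insert k {..n}. d i)"
      using k(1) by simp
    also have "\<dots> \<le> (\<Sum>i\<le>k. d i)"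
      using k(1) d by (intro sum_mono2) auto
    finally show ?case using n k(2) by (intro exI[of _ k]) simp
  qed (use d in \<open>auto intro!: exI[of _ 0]\<close>)
  note large = this
  show ?thesis
    unfolding filterlim_at_top eventually_sequentially
  proof
    fix B :: real
    obtain N where "B \<le> real N" using real_arch_simple by blast
    then obtain n where n: "B \<le> (\<Sum>i\<le>n. d i)" using large[of N] order_trans by blast
    have "B \<le> 1 + (\<Sum>i\<le>m. d i)" if "n \<le> m" for m
      using n sum_mono2[of "{..m}" "{..n}" d] that d by fastforce
    then show "\<exists>n. \<forall>m\<ge>n. B \<le> 1 + (\<Sum>i\<le>m. d i)" by blast
  qed
qed

section \<open>The least squares problem\<close>

text \<open>Completing the square: the normal equation for \<open>alpha_tilde\<close> kills the term
  linear in \<open>a - b\<close>, and the residual at \<open>s\<close> is zero at the proposed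
  minimizer, since \<open>t\<close> occurs in no other term and can absorb it.\<close>

lemma Qn_eq_minimum_plus:
  assumes pos: "(\<Sum>k\<in>{1..n} - {s}. (y (k - 1))\<^sup>2) \<noteq> 0"
  shows "Qn \<mu> s n y a t = Qn \<mu> s n y (alpha_tilde \<mu> s n y) (theta_tilde \<mu> s n y)
    + (a - alpha_tilde \<mu> s n y)\<^sup>2 * (\<Sum>k\<in>{1..n} - {s}. (y (k - 1))\<^sup>2)
    + (y s - a * y (s - 1) - \<mu> - t)\<^sup>2"
proof -
  define K where "K = {1..n} - {s}"
  define b where "b = alpha_tilde \<mu> s n y"
  have b: "b * (\<Sum>k\<in>K. (y (k - 1))\<^sup>2) = (\<Sum>k\<in>K. (y k - \<mu>) * y (k - 1))"
    using pos by (simp add: b_def alpha_tilde_def K_def)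
  have "(\<Sum>k\<in>K. (y k - a * y (k - 1) - \<mu>)\<^sup>2)
      = (\<Sum>k\<in>K. (y k - b * y (k - 1) - \<mu>)\<^sup>2 + (a - b)\<^sup>2 * (y (k - 1))\<^sup>2
          - 2 * (a - b) * ((y k - \<mu>) * y (k - 1) - b * (y (k - 1))\<^sup>2))"
    by (intro sum.cong refl) (simp add: power2_eq_square algebra_simps)
  also have "\<dots> = (\<Sum>k\<in>K. (y k - b * y (k - 1) - \<mu>)\<^sup>2) + (a - b)\<^sup>2 * (\<Sum>k\<in>K. (y (k - 1))\<^sup>2)"
    using b by (simp add: sum.distrib sum_subtractf sum_distrib_left[symmetric])
  finally show ?thesis
    unfolding Qn_def theta_tilde_def K_def[symmetric] b_def[symmetric] by simp
qed

lemma Qn_unique_minimum: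
  assumes pos: "0 < (\<Sum>k\<in>{1..n} - {s}. (y (k - 1))\<^sup>2)"
    and ne: "(a, t) \<noteq> (alpha_tilde \<mu> s n y, theta_tilde \<mu> s n y)"
  shows "Qn \<mu> s n y (alpha_tilde \<mu> s n y) (theta_tilde \<mu> s n y) < Qn \<mu> s n y a t"
proof (cases "a = alpha_tilde \<mu> s n y")
  case True
  then have "y s - a * y (s - 1) - \<mu> - t \<noteq> 0"
    using ne by (auto simp: theta_tilde_def)
  then have "0 < (y s - a * y (s - 1) - \<mu> - t)\<^sup>2" by simp
  then show ?thesis
    using Qn_eq_minimum_plus[of y n s \<mu> a t] pos True by simp
next
  case False
  then have "0 < (a - alpha_tilde \<mu> s n y)\<^sup>2 * (\<Sum>k\<in>{1..n} - {s}. (y (k - 1))\<^sup>2)"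
    using pos by simp
  then show ?thesis
    using Qn_eq_minimum_plus[of y n s \<mu> a t] pos zero_le_power2[of "y s - a * y (s - 1) - \<mu> - t"]
    by linarith
qed

text \<open>Passes from the index of the response to that of the regressor; the omitted response
  \<open>s\<close> becomes a zero term at \<open>Suc k = s\<close>.\<close>

lemma sum_omit_shift:
  "(\<Sum>k\<in>{1..Suc n} - {s}. f k) = (\<Sum>k\<le>n. if Suc k = s then 0 else f (Suc k))"
  for f :: "nat \<Rightarrow> real"
proof -
  have "(\<Sum>k\<in>{1..Suc n} - {s}. f k) = (\<Sum>k\<in>{1..Suc n}. if k = s then 0 else f k)"
    by (intro sum.mono_neutral_cong_left) auto
  also have "\<dots> = (\<Sum>k\<in>{0..n}. if Suc k = s then 0 else f (Suc k))"
    using sum.shift_bounds_cl_Suc_ivl[of "\<lambda>k. if k = s then 0 else f k" 0 n] by simp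
  finally show ?thesis by (simp add: atLeast0AtMost)
qed

section \<open>The INAR(1) process with an outlier\<close>

definition inar_past :: "nat \<Rightarrow> inar_idx set" where
  "inar_past k = {IY0} \<union> {IEps i |i. 1 \<le> i \<and> i \<le> k} \<union> {IXi i j |i j. 1 \<le> i \<and> i \<le> k \<and> 1 \<le> j}"

text \<open>The primitives consumed by the transition out of time \<open>k\<close> from the value
  \<open>y\<close>. Taking \<open>y\<close> as a fixed number keeps the index set finite and
  nonrandom, while \<open>inar_past\<close> must allow every \<open>j\<close> because past values
  are random.\<close>

definition inar_step :: "nat \<Rightarrow> nat \<Rightarrow> inar_idx set" where
  "inar_step k y = insert (IEps (Suc k)) (IXi (Suc k) ` {1..y})"

lemma inar_past_mono: "i \<le> k \<Longrightarrow> inar_past i \<subseteq> inar_past k"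
  by (auto simp: inar_past_def)

lemma finite_inar_step [simp]: "finite (inar_step k y)"
  by (simp add: inar_step_def)

lemma sum_inar_step:
  fixes f :: "inar_idx \<Rightarrow> 'b::comm_monoid_add"
  shows "(\<Sum>i\<in>inar_step k y. f i) = (\<Sum>j\<in>{1..y}. f (IXi (Suc k) j)) + f (IEps (Suc k))"
  by (simp add: inar_step_def sum.reindex inj_on_def image_iff add.commute)

declare inarY.simps(2) [simp del]

lemma inarY_Suc_eq:
  "inarY Z s \<theta> (Suc k) \<omega> = (\<Sum>i\<in>inar_step k (inarY Z s \<theta> k \<omega>). Z i \<omega>) + (if Suc k = s then \<theta> else 0)"
  by (simp add: sum_inar_step inarY.simps(2))

text \<open>Causality of the recursion. The two families may live on different sample spaces, so the
  process can be rebuilt from coordinate functions on a product space.\<close>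

lemma inarY_cong:
  "(\<And>i. i \<in> inar_past k \<Longrightarrow> Z i \<omega> = Z' i \<omega>') \<Longrightarrow> inarY Z s \<theta> k \<omega> = inarY Z' s \<theta> k \<omega>'"
proof (induction k)
  case (Suc k)
  have "inarY Z s \<theta> k \<omega> = inarY Z' s \<theta> k \<omega>'"
    using Suc inar_past_mono[of k "Suc k"] by auto
  then show ?case
    using Suc.prems by (auto simp: inar_past_def inarY.simps(2) intro!: sum.cong)
qed (simp add: inar_past_def)

lemma measurable_inarY:
  "(\<And>i. i \<in> inar_past k \<Longrightarrow> Z i \<in> measurable N (count_space UNIV)) \<Longrightarrow>
    inarY Z s \<theta> k \<in> measurable N (count_space UNIV)"
proof (induction k)
  case (Suc k)
  have "inarY Z s \<theta> k \<in> measurable N (count_space UNIV)"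
    using Suc inar_past_mono[of k "Suc k"] by auto
  moreover have "(\<lambda>\<omega>. (\<Sum>i\<in>inar_step k y. Z i \<omega>) + (if Suc k = s then \<theta> else 0)) \<in> measurable N (count_space UNIV)" for y
  proof -
    have [measurable]: "Z i \<in> measurable N (count_space UNIV)" if "i \<in> inar_step k y" for i
      using that by (intro Suc.prems) (auto simp: inar_step_def inar_past_def)
    show ?thesis by measurable
  qed
  \<comment> \<open>The random number of summands is treated by fixing its value \<open>y\<close>
    and gluing over the countably many values.\<close>
  ultimately show ?case
    unfolding inarY_Suc_eq by (rule measurable_compose_countable[rotated])
next
  case 0
  have "inarY Z s \<theta> 0 = Z IY0" by (rule ext) simp
  then show ?case using 0 by (simp add: inar_past_def)
qed

text \<open>Lists of naturals form a countable type, so the sigma-algebra generated by the history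
  is atomic; the current value is the last entry.\<close>

definition inar_history :: "(inar_idx \<Rightarrow> 'a \<Rightarrow> nat) \<Rightarrow> nat \<Rightarrow> nat \<Rightarrow> nat \<Rightarrow> 'a \<Rightarrow> nat list" where
  "inar_history Z s \<theta> k \<omega> = map (\<lambda>i. inarY Z s \<theta> i \<omega>) [0..<Suc k]"

lemma inar_history_nth: "i \<le> k \<Longrightarrow> inar_history Z s \<theta> k \<omega> ! i = inarY Z s \<theta> i \<omega>"
  unfolding inar_history_def by (subst nth_map) (auto simp del: upt_Suc)

lemma last_inar_history: "last (inar_history Z s \<theta> k \<omega>) = inarY Z s \<theta> k \<omega>"
  by (simp add: inar_history_def)

lemma take_inar_history: "m \<le> n \<Longrightarrow> take (Suc m) (inar_history Z s \<theta> n \<omega>) = inar_history Z s \<theta> m \<omega>"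
  by (simp add: inar_history_def take_map take_upt del: upt_Suc)

lemma measurable_inar_history:
  assumes "\<And>i. i \<in> inar_past k \<Longrightarrow> Z i \<in> measurable N (count_space UNIV)"
  shows "inar_history Z s \<theta> k \<in> measurable N (count_space UNIV)"
proof -
  have Y: "inarY Z s \<theta> i \<in> measurable N (count_space UNIV)" if "i \<in> set [0..<Suc k]" for i
    using that by (intro measurable_inarY assms subsetD[OF inar_past_mono[of i k]]) auto
  have "(\<lambda>\<omega>. map (\<lambda>i. inarY Z s \<theta> i \<omega>) is) \<in> measurable N (count_space UNIV)"
    if "set is \<subseteq> set [0..<Suc k]" for "is"
    using that
  proof (induction "is")
    case (Cons i "is")
    then have "(\<lambda>\<omega>. y # map (\<lambda>i. inarY Z s \<theta> i \<omega>) is) \<in> measurable N (count_space UNIV)" for y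
      by (intro measurable_compose[of _ N "count_space UNIV" "(#) y"]) auto
    moreover have "inarY Z s \<theta> i \<in> measurable N (count_space UNIV)"
      using Cons.prems by (intro Y) auto
    ultimately show ?case
      using measurable_compose_countable[of "\<lambda>y \<omega>. y # map (\<lambda>i. inarY Z s \<theta> i \<omega>) is" N _ "inarY Z s \<theta> i"] by simp
  qed simp
  from this[of "[0..<Suc k]"] show ?thesis
    by (simp add: inar_history_def [abs_def] del: upt_Suc)
qed

section \<open>Moments of the primitives and of a single transition\<close>

locale inar_outlier = prob_space M for M :: "'a measure" +
  fixes Z :: "inar_idx \<Rightarrow> 'a \<Rightarrow> nat" and \<alpha> :: real and s \<theta> :: nat
  assumes \<alpha>: "0 < \<alpha>" "\<alpha> < 1"
    and indep: "indep_vars (\<lambda>_. count_space UNIV) Z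
        ({IY0} \<union> {IEps k |k. 1 \<le> k} \<union> {IXi k j |k j. 1 \<le> k \<and> 1 \<le> j})"
    and eps_iid: "\<And>k. 1 \<le> k \<Longrightarrow>
        distr M (count_space UNIV) (Z (IEps k)) = distr M (count_space UNIV) (Z (IEps 1))"
    and eps_sq: "integrable M (\<lambda>\<omega>. (real (Z (IEps 1) \<omega>))\<^sup>2)"
    and eps_nz: "prob {\<omega>\<in>space M. Z (IEps 1) \<omega> \<noteq> 0} > 0"
    and xi_bern: "\<And>k j. 1 \<le> k \<Longrightarrow> 1 \<le> j \<Longrightarrow>
        distr M (count_space UNIV) (Z (IXi k j)) = measure_pmf (map_pmf of_bool (bernoulli_pmf \<alpha>))"
    and Y0_sq: "integrable M (\<lambda>\<omega>. (real (Z IY0 \<omega>))\<^sup>2)"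
begin

definition "idx = {IY0} \<union> {IEps k |k. 1 \<le> k} \<union> {IXi k j |k j. 1 \<le> k \<and> 1 \<le> j}"
definition "\<mu> = expectation (\<lambda>\<omega>. real (Z (IEps 1) \<omega>))"
definition "\<sigma>2 = variance (\<lambda>\<omega>. real (Z (IEps 1) \<omega>))"

abbreviation Y :: "nat \<Rightarrow> 'a \<Rightarrow> nat" where "Y \<equiv> inarY Z s \<theta>"
abbreviation hist :: "nat \<Rightarrow> 'a \<Rightarrow> nat list" where "hist \<equiv> inar_history Z s \<theta>"
definition F :: "nat \<Rightarrow> 'a measure" where
  "F k = vimage_algebra (space M) (hist k) (count_space UNIV)"
text \<open>The noise of one transition with the current value frozen at \<open>y\<close>;
  \<open>noise\<close> puts the random value \<open>Y k\<close> back in.\<close>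

definition innov :: "nat \<Rightarrow> nat \<Rightarrow> 'a \<Rightarrow> real" where
  "innov k y \<omega> = real (\<Sum>i\<in>inar_step k y. Z i \<omega>) - \<alpha> * real y - \<mu>"
definition noise :: "nat \<Rightarrow> 'a \<Rightarrow> real" where
  "noise k \<omega> = innov k (Y k \<omega>) \<omega>"

lemma past_subset_idx: "inar_past k \<subseteq> idx"
  by (auto simp: inar_past_def idx_def)

lemma step_subset_idx: "inar_step k y \<subseteq> idx"
  by (auto simp: inar_step_def idx_def)

lemma past_step_disjoint: "inar_past k \<inter> inar_step k y = {}"
  by (auto simp: inar_past_def inar_step_def)

lemma measurable_Z: "i \<in> idx \<Longrightarrow> Z i \<in> measurable M (count_space UNIV)"
  using indep by (auto simp: indep_vars_def idx_def)

lemma measurable_Y [measurable]: "Y k \<in> measurable M (count_space UNIV)"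
  using past_subset_idx by (intro measurable_inarY measurable_Z) auto

lemma measurable_hist [measurable]: "hist k \<in> measurable M (count_space UNIV)"
  using past_subset_idx by (intro measurable_inar_history measurable_Z) auto

lemma measurable_innov [measurable]: "innov k y \<in> borel_measurable M"
proof -
  have [measurable]: "Z i \<in> measurable M (count_space UNIV)" if "i \<in> inar_step k y" for i
    using that step_subset_idx measurable_Z by blast
  show ?thesis unfolding innov_def by measurable
qed

lemma Y_Suc: "real (Y (Suc k) \<omega>) = \<alpha> * real (Y k \<omega>) + \<mu> + noise k \<omega> + (if Suc k = s then real \<theta> else 0)"
  unfolding noise_def innov_def inarY_Suc_eq by simp

lemma measurable_noise [measurable]: "noise k \<in> borel_measurable M"
proof -
  have "noise k = (\<lambda>\<omega>. real (Y (Suc k) \<omega>) - \<alpha> * real (Y k \<omega>) - \<mu> - (if Suc k = s then real \<theta> else 0))"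
    by (simp only: Y_Suc) simp
  then show ?thesis by simp
qed

lemma
  assumes "1 \<le> k"
  shows integrable_eps_square: "integrable M (\<lambda>\<omega>. (real (Z (IEps k) \<omega>))\<^sup>2)"
    and expectation_eps: "expectation (\<lambda>\<omega>. real (Z (IEps k) \<omega>)) = \<mu>"
    and variance_eps: "expectation (\<lambda>\<omega>. (real (Z (IEps k) \<omega>) - \<mu>)\<^sup>2) = \<sigma>2"
    and prob_eps_eq_0: "prob {\<omega>\<in>space M. Z (IEps k) \<omega> = 0} = prob {\<omega>\<in>space M. Z (IEps 1) \<omega> = 0}"
proof -
  have [measurable]: "Z (IEps i) \<in> measurable M (count_space UNIV)" if "1 \<le> i" for i
    using that by (intro measurable_Z) (auto simp: idx_def)
  have int: "integrable M (\<lambda>\<omega>. f (Z (IEps k) \<omega>)) \<longleftrightarrow> integrable M (\<lambda>\<omega>. f (Z (IEps 1) \<omega>))" for f :: "nat \<Rightarrow> real"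
    using integrable_distr_eq[of "Z (IEps k)" M "count_space UNIV" f]
      integrable_distr_eq[of "Z (IEps 1)" M "count_space UNIV" f] eps_iid[OF assms] assms by simp
  have ex: "expectation (\<lambda>\<omega>. f (Z (IEps k) \<omega>)) = expectation (\<lambda>\<omega>. f (Z (IEps 1) \<omega>))" for f :: "nat \<Rightarrow> real"
    using integral_distr[of "Z (IEps k)" M "count_space UNIV" f]
      integral_distr[of "Z (IEps 1)" M "count_space UNIV" f] eps_iid[OF assms] assms by simp
  show "integrable M (\<lambda>\<omega>. (real (Z (IEps k) \<omega>))\<^sup>2)"
    using int[of "\<lambda>x. (real x)\<^sup>2"] eps_sq by simp
  show "expectation (\<lambda>\<omega>. real (Z (IEps k) \<omega>)) = \<mu>"
    using ex[of real] by (simp add: \<mu>_def)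
  show "expectation (\<lambda>\<omega>. (real (Z (IEps k) \<omega>) - \<mu>)\<^sup>2) = \<sigma>2"
    using ex[of "\<lambda>x. (real x - \<mu>)\<^sup>2"] by (simp add: \<mu>_def \<sigma>2_def)
  have "measure (distr M (count_space UNIV) (Z (IEps i))) {0} = prob {\<omega>\<in>space M. Z (IEps i) \<omega> = 0}" if "1 \<le> i" for i
  proof -
    have "Z (IEps i) -` {0} \<inter> space M = {\<omega>\<in>space M. Z (IEps i) \<omega> = 0}" by auto
    then show ?thesis
      using that by (simp add: measure_distr)
  qed
  from this[of k] this[of 1] show "prob {\<omega>\<in>space M. Z (IEps k) \<omega> = 0} = prob {\<omega>\<in>space M. Z (IEps 1) \<omega> = 0}"
    using assms eps_iid[OF assms] by simp
qed

lemma
  assumes "1 \<le> k" "1 \<le> j"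
  shows AE_xi_le_1: "AE \<omega> in M. Z (IXi k j) \<omega> \<le> 1"
    and integrable_xi_square: "integrable M (\<lambda>\<omega>. (real (Z (IXi k j) \<omega>))\<^sup>2)"
    and expectation_xi: "expectation (\<lambda>\<omega>. real (Z (IXi k j) \<omega>)) = \<alpha>"
    and variance_xi: "expectation (\<lambda>\<omega>. (real (Z (IXi k j) \<omega>) - \<alpha>)\<^sup>2) = \<alpha> * (1 - \<alpha>)"
proof -
  have [measurable]: "Z (IXi k j) \<in> measurable M (count_space UNIV)"
    using assms by (intro measurable_Z) (auto simp: idx_def)
  have "AE x in distr M (count_space UNIV) (Z (IXi k j)). x \<le> 1"
    unfolding xi_bern[OF assms] by (auto simp: AE_measure_pmf_iff)
  then show le: "AE \<omega> in M. Z (IXi k j) \<omega> \<le> 1"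
    by (subst (asm) AE_distr_iff) auto
  show "integrable M (\<lambda>\<omega>. (real (Z (IXi k j) \<omega>))\<^sup>2)"
    by (rule integrable_const_bound[where B=1])
       (use le in \<open>auto simp: power_le_one elim!: eventually_mono\<close>)
  have ex: "expectation (\<lambda>\<omega>. f (Z (IXi k j) \<omega>)) = \<alpha> * f 1 + (1 - \<alpha>) * f 0" for f :: "nat \<Rightarrow> real"
    using integral_distr[of "Z (IXi k j)" M "count_space UNIV" f] \<alpha>
    unfolding xi_bern[OF assms] by (simp add: algebra_simps)
  show "expectation (\<lambda>\<omega>. real (Z (IXi k j) \<omega>)) = \<alpha>"
    using ex[of real] by simp
  show "expectation (\<lambda>\<omega>. (real (Z (IXi k j) \<omega>) - \<alpha>)\<^sup>2) = \<alpha> * (1 - \<alpha>)"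
    using ex[of "\<lambda>x. (real x - \<alpha>)\<^sup>2"] by (simp add: power2_eq_square algebra_simps)
qed

text \<open>For fixed \<open>y\<close> the transition noise is a sum of \<open>y\<close> centred
  Bernoulli variables and one centred innovation, all independent, so the variances
  \<open>\<alpha> * (1 - \<alpha>)\<close> and \<open>\<sigma>2\<close> add.\<close>

lemma
  shows integrable_innov_square: "integrable M (\<lambda>\<omega>. (innov k y \<omega>)\<^sup>2)"
    and expectation_innov: "expectation (innov k y) = 0"
    and expectation_innov_square:
      "expectation (\<lambda>\<omega>. (innov k y \<omega>)\<^sup>2) = \<alpha> * (1 - \<alpha>) * real y + \<sigma>2"
proof -
  define m where "m i = (case i of IXi _ _ \<Rightarrow> \<alpha> | _ \<Rightarrow> \<mu>)" for i
  define W where "W i \<omega> = real (Z i \<omega>) - m i" for i \<omega>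
  have Z_meas [measurable]: "Z i \<in> measurable M (count_space UNIV)" if "i \<in> inar_step k y" for i
    using that step_subset_idx measurable_Z by blast
  have innov_eq: "innov k y \<omega> = (\<Sum>i\<in>inar_step k y. W i \<omega>)" for \<omega>
    by (simp add: innov_def W_def sum_inar_step m_def sum_subtractf)
  have Z_sq: "integrable M (\<lambda>\<omega>. (real (Z i \<omega>))\<^sup>2)" if "i \<in> inar_step k y" for i
    using that integrable_eps_square integrable_xi_square by (auto simp: inar_step_def)
  have W_sq: "integrable M (\<lambda>\<omega>. (W i \<omega>)\<^sup>2)" if "i \<in> inar_step k y" for i
    using that Z_sq[OF that] integrable_power2_add[of "\<lambda>\<omega>. real (Z i \<omega>)" M "\<lambda>\<omega>. - m i"] by (simp add: W_def)
  have Z_int: "integrable M (\<lambda>\<omega>. real (Z i \<omega>))" if "i \<in> inar_step k y" for i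
    using that by (intro square_integrable_imp_integrable[OF _ Z_sq[OF that]]) measurable
  have W_ex: "expectation (W i) = 0" if "i \<in> inar_step k y" for i
  proof -
    have "expectation (W i) = expectation (\<lambda>\<omega>. real (Z i \<omega>)) - m i"
      using Z_int[OF that] by (simp add: W_def [abs_def] prob_space)
    also have "expectation (\<lambda>\<omega>. real (Z i \<omega>)) = m i"
      using that expectation_eps[of "Suc k"] expectation_xi[of "Suc k"]
      by (auto simp: m_def inar_step_def)
    finally show ?thesis by simp
  qed
  have "indep_vars (\<lambda>_. count_space UNIV) Z (inar_step k y)"
    using indep_vars_subset[OF indep] step_subset_idx by (simp add: idx_def)
  then have "indep_vars (\<lambda>_. borel) (\<lambda>i \<omega>. (\<lambda>z. real z - m i) (Z i \<omega>)) (inar_step k y)"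
    by (rule indep_vars_compose2) simp
  then have W_indep: "indep_vars (\<lambda>_. borel) W (inar_step k y)"
    by (simp add: W_def [abs_def])
  note W = finite_inar_step W_indep W_sq W_ex
  show "integrable M (\<lambda>\<omega>. (innov k y \<omega>)\<^sup>2)"
    unfolding innov_eq by (rule integrable_indep_sum_square[OF W])
  have "integrable M (W i)" if "i \<in> inar_step k y" for i
    using Z_int[OF that] by (simp add: W_def [abs_def])
  then show "expectation (innov k y) = 0"
    using W_ex by (simp add: innov_eq [abs_def])
  have "expectation (\<lambda>\<omega>. (innov k y \<omega>)\<^sup>2) = expectation (\<lambda>\<omega>. (\<Sum>i\<in>inar_step k y. W i \<omega>)\<^sup>2)"
    by (simp only: innov_eq)
  also have "\<dots> = (\<Sum>i\<in>inar_step k y. expectation (\<lambda>\<omega>. (W i \<omega>)\<^sup>2))"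
    by (rule expectation_indep_sum_square[OF W])
  also have "\<dots> = (\<Sum>j\<in>{1..y}. \<alpha> * (1 - \<alpha>)) + \<sigma>2"
    unfolding sum_inar_step using variance_eps[of "Suc k"] variance_xi[of "Suc k"]
    by (intro arg_cong2[where f="(+)"] sum.cong) (auto simp: W_def m_def)
  finally show "expectation (\<lambda>\<omega>. (innov k y \<omega>)\<^sup>2) = \<alpha> * (1 - \<alpha>) * real y + \<sigma>2"
    by simp
qed

lemma indep_hist_innov:
  assumes [measurable]: "f \<in> borel_measurable borel"
  shows "indep_var borel (\<lambda>\<omega>. indicator {h} (hist k \<omega>)) borel (\<lambda>\<omega>. f (innov k y \<omega>) :: real)"
proof -
  let ?N = "\<lambda>_::inar_idx. count_space (UNIV :: nat set)"
  let ?R = "\<lambda>A \<omega>. \<lambda>i\<in>A. Z i \<omega>"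
  \<comment> \<open>The history rebuilt on the product space, with coordinates as primitives; this
    exhibits it as a measurable function of the restricted family.\<close>
  let ?H = "inar_history (\<lambda>i p. p i) s \<theta> k :: (inar_idx \<Rightarrow> nat) \<Rightarrow> nat list"
  let ?S = "\<lambda>p. f (real (\<Sum>i\<in>inar_step k y. p i) - \<alpha> * real y - \<mu>)"
  have [measurable]: "?H \<in> measurable (PiM (inar_past k) ?N) (count_space UNIV)"
    by (rule measurable_inar_history) measurable
  have "indep_var borel ((\<lambda>p. indicator {h} (?H p)) \<circ> ?R (inar_past k)) borel (?S \<circ> ?R (inar_step k y))"
    using past_step_disjoint past_subset_idx step_subset_idx
    by (intro indep_var_compose[OF indep_var_restrict[OF indep, folded idx_def]]) auto
  moreover have "inarY (\<lambda>i p. p i) s \<theta> l (?R (inar_past k) \<omega>) = Y l \<omega>" if "l \<in> set [0..<Suc k]" for l \<omega>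
  proof (rule inarY_cong)
    have "l \<le> k" using that by auto
    then show "?R (inar_past k) \<omega> i = Z i \<omega>" if "i \<in> inar_past l" for i
      using that inar_past_mono[of l k] by auto
  qed
  then have "?H (?R (inar_past k) \<omega>) = hist k \<omega>" for \<omega>
    unfolding inar_history_def by (intro map_cong refl)
  ultimately show ?thesis
    by (simp add: comp_def innov_def)
qed

section \<open>The observed filtration and the conditional moments of the noise\<close>

lemma subalgebra_F: "subalgebra M (F k)"
  using measurable_hist unfolding F_def by (auto simp: subalgebra_def measurable_iff_sets)

lemma measurable_hist_F: "hist k \<in> measurable (F k) (count_space UNIV)"
  unfolding F_def by (rule measurable_vimage_algebra1) auto

lemma subalgebra_F_mono:
  assumes "m \<le> n"
  shows "subalgebra (F n) (F m)"
proof -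
  have "(\<lambda>\<omega>. take (Suc m) (hist n \<omega>)) \<in> measurable (F n) (count_space UNIV)"
    using measurable_hist_F by (rule measurable_compose) simp
  then have "hist m \<in> measurable (F n) (count_space UNIV)"
    by (simp only: take_inar_history[OF assms])
  then show ?thesis
    unfolding F_def by (auto simp: subalgebra_def measurable_iff_sets)
qed

lemma measurable_Y_F:
  assumes "i \<le> k"
  shows "Y i \<in> measurable (F k) (count_space UNIV)"
proof -
  have "(\<lambda>\<omega>. hist k \<omega> ! i) \<in> measurable (F k) (count_space UNIV)"
    using measurable_hist_F by (rule measurable_compose) simp
  then show ?thesis
    by (simp only: inar_history_nth[OF assms])
qed

text \<open>Thinning almost surely never increases the population, so each value is at most the
  previous one plus the innovation and \<open>\<theta>\<close>.\<close>

lemma integrable_Y_square: "integrable M (\<lambda>\<omega>. (real (Y k \<omega>))\<^sup>2)"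
proof (induction k)
  case (Suc k)
  have [measurable]: "Z (IEps (Suc k)) \<in> measurable M (count_space UNIV)"
    by (intro measurable_Z) (auto simp: idx_def)
  have bound: "integrable M (\<lambda>\<omega>. (real (Y k \<omega>) + (real (Z (IEps (Suc k)) \<omega>) + real \<theta>))\<^sup>2)"
    using Suc integrable_eps_square[of "Suc k"] by (intro integrable_power2_add) auto
  have "AE \<omega> in M. \<forall>j. Z (IXi (Suc k) (Suc j)) \<omega> \<le> 1"
    by (simp add: AE_all_countable AE_xi_le_1[of "Suc k", simplified])
  then have "AE \<omega> in M. norm ((real (Y (Suc k) \<omega>))\<^sup>2)
      \<le> norm ((real (Y k \<omega>) + (real (Z (IEps (Suc k)) \<omega>) + real \<theta>))\<^sup>2)"
  proof eventually_elim
    case (elim \<omega>)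
    have "Z (IXi (Suc k) j) \<omega> \<le> 1" if "1 \<le> j" for j
      using elim that by (cases j) auto
    then have "(\<Sum>j\<in>{1..Y k \<omega>}. Z (IXi (Suc k) j) \<omega>) \<le> (\<Sum>j\<in>{1..Y k \<omega>}. 1)"
      by (intro sum_mono) auto
    then have "(\<Sum>j\<in>{1..Y k \<omega>}. Z (IXi (Suc k) j) \<omega>) \<le> Y k \<omega>"
      by simp
    moreover have "(if Suc k = s then \<theta> else 0) \<le> \<theta>" by simp
    ultimately have "Y (Suc k) \<omega> \<le> Y k \<omega> + (Z (IEps (Suc k)) \<omega> + \<theta>)"
      unfolding inarY.simps(2) by linarith
    then have "real (Y (Suc k) \<omega>) \<le> real (Y k \<omega>) + (real (Z (IEps (Suc k)) \<omega>) + real \<theta>)"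
      by linarith
    then show ?case
      by (auto intro!: power_mono)
  qed
  then show ?case
    by (rule Bochner_Integration.integrable_bound[OF bound, rotated]) measurable
qed (use Y0_sq in simp)

lemma integrable_Y: "integrable M (\<lambda>\<omega>. real (Y k \<omega>))"
  by (rule square_integrable_imp_integrable[OF _ integrable_Y_square]) measurable

lemma integrable_noise_square: "integrable M (\<lambda>\<omega>. (noise k \<omega>)\<^sup>2)"
proof -
  have eq: "noise k \<omega> = real (Y (Suc k) \<omega>) + (- \<alpha> * real (Y k \<omega>) + (- \<mu> - (if Suc k = s then real \<theta> else 0)))" for \<omega>
    by (simp only: Y_Suc)
  show ?thesis
    unfolding eq
    by (intro integrable_power2_add) (use integrable_Y_square in \<open>auto simp: power_mult_distrib\<close>)
qed

lemma integrable_noise: "integrable M (noise k)"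
  by (rule square_integrable_imp_integrable[OF _ integrable_noise_square]) measurable

text \<open>Conditionally on the past, the step from time $k$ is a sum of independent centred variables
  whose number $Y_k$ is known; it suffices to integrate over the atoms of the countably valued history.\<close>

lemma cond_exp_noise: "AE \<omega> in M. real_cond_exp M (F k) (noise k) \<omega> = 0"
proof -
  let ?V = "\<lambda>h \<omega>. innov k (last h) \<omega>"
  have int: "integrable M (innov k y)" for y
    by (rule square_integrable_imp_integrable[OF _ integrable_innov_square]) measurable
  have "AE \<omega> in M. real_cond_exp M (vimage_algebra (space M) (hist k) (count_space UNIV))
      (\<lambda>\<omega>. ?V (hist k \<omega>) \<omega>) \<omega> = 0"
    by (rule real_cond_exp_vimage_count_space_eq_0)
       (use indep_hist_innov[of "\<lambda>x. x"] int integrable_noise[of k] in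
         \<open>auto simp: expectation_innov last_inar_history noise_def [abs_def]\<close>)
  then show ?thesis
    by (simp add: F_def last_inar_history noise_def [abs_def])
qed

text \<open>The conditional variance is expressed as a difference with vanishing conditional
  expectation, the form to which freezing applies.\<close>

lemma cond_exp_noise_square:
  "AE \<omega> in M. real_cond_exp M (F k) (\<lambda>\<omega>. (noise k \<omega>)\<^sup>2 - (\<alpha> * (1 - \<alpha>) * real (Y k \<omega>) + \<sigma>2)) \<omega> = 0"
proof -
  let ?V = "\<lambda>h \<omega>. (innov k (last h) \<omega>)\<^sup>2 - (\<alpha> * (1 - \<alpha>) * real (last h) + \<sigma>2)"
  have "AE \<omega> in M. real_cond_exp M (vimage_algebra (space M) (hist k) (count_space UNIV))
      (\<lambda>\<omega>. ?V (hist k \<omega>) \<omega>) \<omega> = 0"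
  proof (rule real_cond_exp_vimage_count_space_eq_0)
    show "indep_var borel (\<lambda>\<omega>. indicator {h} (hist k \<omega>)) borel (?V h)" for h
      using indep_hist_innov[of "\<lambda>x. x\<^sup>2 - (\<alpha> * (1 - \<alpha>) * real (last h) + \<sigma>2)"] by simp
    show "integrable M (\<lambda>\<omega>. ?V (hist k \<omega>) \<omega>)"
      using integrable_noise_square[of k] integrable_Y[of k]
      by (simp add: last_inar_history noise_def)
  qed (use integrable_innov_square in \<open>auto simp: expectation_innov_square prob_space\<close>)
  then show ?thesis
    by (simp add: F_def last_inar_history noise_def [abs_def])
qed

section \<open>The weighted noise and the summability of its second moments\<close>

text \<open>The outlier step $k + 1 = s$ is given weight $0$; the summand $1$ keeps \<open>D\<close> away from $0$.\<close>

definition x :: "nat \<Rightarrow> 'a \<Rightarrow> real" where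
  "x k \<omega> = (if Suc k = s then 0 else real (Y k \<omega>))"
definition D :: "nat \<Rightarrow> 'a \<Rightarrow> real" where
  "D k \<omega> = 1 + (\<Sum>i\<le>k. (x i \<omega>)\<^sup>2)"
definition w :: "nat \<Rightarrow> 'a \<Rightarrow> real" where
  "w k \<omega> = x k \<omega> / D k \<omega>"

lemma D_ge_1: "1 \<le> D k \<omega>"
  by (simp add: D_def sum_nonneg)

lemma x_square_le_D: "(x k \<omega>)\<^sup>2 \<le> D k \<omega>"
  using member_le_sum[of k "{..k}" "\<lambda>i. (x i \<omega>)\<^sup>2"] by (simp add: D_def)

lemma x_le_sqrt_D: "x k \<omega> \<le> sqrt (D k \<omega>)"
  using x_square_le_D by (rule real_le_rsqrt)

lemma x_nonneg: "0 \<le> x k \<omega>"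
  by (simp add: x_def)

lemma w_bounds: "0 \<le> w k \<omega>" "w k \<omega> \<le> 1"
proof -
  have "sqrt (D k \<omega>) \<le> D k \<omega>"
    using D_ge_1[of k \<omega>] by (intro real_le_lsqrt) (auto simp: power2_eq_square)
  then have "x k \<omega> \<le> D k \<omega>"
    using x_le_sqrt_D[of k \<omega>] by linarith
  then show "0 \<le> w k \<omega>" "w k \<omega> \<le> 1"
    using D_ge_1[of k \<omega>] x_nonneg[of k \<omega>] by (auto simp: w_def)
qed

lemma measurable_x_F: "i \<le> k \<Longrightarrow> x i \<in> borel_measurable (F k)"
proof -
  assume "i \<le> k"
  note [measurable] = measurable_Y_F[OF this]
  show "x i \<in> borel_measurable (F k)"
    unfolding x_def [abs_def] by measurable
qed

lemma measurable_w_F: "w k \<in> borel_measurable (F k)"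
  unfolding w_def [abs_def] D_def
  by (intro borel_measurable_divide borel_measurable_add borel_measurable_sum borel_measurable_power
      borel_measurable_const measurable_x_F) auto

lemma measurable_x [measurable]: "x k \<in> borel_measurable M"
  using measurable_from_subalg[OF subalgebra_F measurable_x_F[of k k]] by simp

lemma measurable_w [measurable]: "w k \<in> borel_measurable M"
  using measurable_from_subalg[OF subalgebra_F measurable_w_F] .

lemma measurable_D [measurable]: "D k \<in> borel_measurable M"
  unfolding D_def [abs_def] by measurable

lemma integrable_bounded_mult:
  assumes [measurable]: "g \<in> borel_measurable M" and int: "integrable M f" and g: "\<And>\<omega>. 0 \<le> g \<omega>" "\<And>\<omega>. g \<omega> \<le> 1"
  shows "integrable M (\<lambda>\<omega>. g \<omega> * f \<omega> :: real)"
proof (rule Bochner_Integration.integrable_bound[OF int])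
  have [measurable]: "f \<in> borel_measurable M"
    using int by auto
  show "(\<lambda>\<omega>. g \<omega> * f \<omega>) \<in> borel_measurable M" by measurable
  show "AE \<omega> in M. norm (g \<omega> * f \<omega>) \<le> norm (f \<omega>)"
    using g by (intro AE_I2) (auto simp: abs_mult intro!: mult_left_le_one_le)
qed

lemma integrable_weighted_noise_square: "integrable M (\<lambda>\<omega>. (w k \<omega> * noise k \<omega>)\<^sup>2)"
  unfolding power_mult_distrib
  by (intro integrable_bounded_mult integrable_noise_square)
     (use w_bounds in \<open>auto intro: power_le_one\<close>)

lemma martingale_diff: "square_integrable_martingale_diff M F (\<lambda>k \<omega>. w k \<omega> * noise k \<omega>)"
proof unfold_locales
  fix k
  show "subalgebra M (F k)" by (rule subalgebra_F)
  interpret sub: finite_measure_subalgebra M "F k"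
    by unfold_locales (rule subalgebra_F)
  \<comment> \<open>The filtration sees only the path, not the primitives, so adaptedness is read
    off from the regression equation.\<close>
  have noise_eq: "noise k = (\<lambda>\<omega>. real (Y (Suc k) \<omega>) - \<alpha> * real (Y k \<omega>) - \<mu> - (if Suc k = s then real \<theta> else 0))"
    by (simp add: Y_Suc)
  have [measurable]: "Y (Suc k) \<in> measurable (F (Suc k)) (count_space UNIV)"
    "Y k \<in> measurable (F (Suc k)) (count_space UNIV)"
    by (simp_all add: measurable_Y_F)
  have [measurable]: "w k \<in> borel_measurable (F (Suc k))"
    using measurable_from_subalg[OF subalgebra_F_mono measurable_w_F, of k "Suc k"] by simp
  show "(\<lambda>\<omega>. w k \<omega> * noise k \<omega>) \<in> borel_measurable (F (Suc k))"
    unfolding noise_eq by measurable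
  have "integrable M (\<lambda>\<omega>. w k \<omega> * noise k \<omega>)"
    by (intro integrable_bounded_mult integrable_noise w_bounds) measurable
  then have "AE \<omega> in M. real_cond_exp M (F k) (\<lambda>\<omega>. w k \<omega> * noise k \<omega>) \<omega>
      = w k \<omega> * real_cond_exp M (F k) (noise k) \<omega>"
    by (intro sub.real_cond_exp_mult measurable_w_F) auto
  then show "AE \<omega> in M. real_cond_exp M (F k) (\<lambda>\<omega>. w k \<omega> * noise k \<omega>) \<omega> = 0"
    using cond_exp_noise[of k] by eventually_elim simp
qed (fact subalgebra_F_mono integrable_weighted_noise_square)+

lemma integrable_normalized_square: "integrable M (\<lambda>\<omega>. (x k \<omega>)\<^sup>2 / (D k \<omega> * sqrt (D k \<omega>)))"
proof (rule integrable_const_bound[where B=1])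
  have "norm ((x k \<omega>)\<^sup>2 / (D k \<omega> * sqrt (D k \<omega>))) \<le> 1" for \<omega>
  proof -
    have "(x k \<omega>)\<^sup>2 * 1 \<le> D k \<omega> * sqrt (D k \<omega>)"
      using D_ge_1[of k \<omega>] x_square_le_D[of k \<omega>] by (intro mult_mono) auto
    then show ?thesis
      using D_ge_1[of k \<omega>] by (simp add: abs_mult)
  qed
  then show "AE \<omega> in M. norm ((x k \<omega>)\<^sup>2 / (D k \<omega> * sqrt (D k \<omega>))) \<le> 1"
    by (rule AE_I2)
qed measurable

lemma \<sigma>2_nonneg: "0 \<le> \<sigma>2"
  by (simp add: \<sigma>2_def)

text \<open>The conditional variance of the noise is only linear in $Y_k \le \sqrt{D_k}$, which turns the
  cubic term $Y_k^3 / D_k^2$ into a summable one without assuming third moments.\<close>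

lemma expectation_weighted_noise_square:
  "expectation (\<lambda>\<omega>. (w k \<omega> * noise k \<omega>)\<^sup>2)
    \<le> (1 + \<sigma>2) * expectation (\<lambda>\<omega>. (x k \<omega>)\<^sup>2 / (D k \<omega> * sqrt (D k \<omega>)))"
proof -
  interpret sub: finite_measure_subalgebra M "F k"
    by unfold_locales (rule subalgebra_F)
  let ?v = "\<lambda>\<omega>. \<alpha> * (1 - \<alpha>) * real (Y k \<omega>) + \<sigma>2"
  have w2 [measurable]: "(\<lambda>\<omega>. (w k \<omega>)\<^sup>2) \<in> borel_measurable (F k)"
    using measurable_w_F by measurable
  have w2_bounds: "0 \<le> (w k \<omega>)\<^sup>2" "(w k \<omega>)\<^sup>2 \<le> 1" for \<omega>
    using w_bounds[of k \<omega>] by (auto intro: power_le_one)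
  have int1: "integrable M (\<lambda>\<omega>. (w k \<omega>)\<^sup>2 * (noise k \<omega>)\<^sup>2)"
    using w2_bounds by (intro integrable_bounded_mult integrable_noise_square) measurable
  have int2: "integrable M (\<lambda>\<omega>. (w k \<omega>)\<^sup>2 * ?v \<omega>)"
    using w2_bounds integrable_Y[of k] by (intro integrable_bounded_mult) auto
  have dist: "(w k \<omega>)\<^sup>2 * ((noise k \<omega>)\<^sup>2 - ?v \<omega>) = (w k \<omega>)\<^sup>2 * (noise k \<omega>)\<^sup>2 - (w k \<omega>)\<^sup>2 * ?v \<omega>" for \<omega>
    by (rule right_diff_distrib)
  have int: "integrable M (\<lambda>\<omega>. (w k \<omega>)\<^sup>2 * ((noise k \<omega>)\<^sup>2 - ?v \<omega>))"
    unfolding dist using int1 int2 by (rule Bochner_Integration.integrable_diff)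
  \<comment> \<open>Since the squared weight is known at time \<open>k\<close>, integrating against
    it replaces the squared noise by its conditional variance.\<close>
  have "expectation (\<lambda>\<omega>. (w k \<omega>)\<^sup>2 * ((noise k \<omega>)\<^sup>2 - ?v \<omega>))
      = expectation (\<lambda>\<omega>. (w k \<omega>)\<^sup>2 * real_cond_exp M (F k) (\<lambda>\<omega>. (noise k \<omega>)\<^sup>2 - ?v \<omega>) \<omega>)"
    by (rule sub.real_cond_exp_intg(2)[symmetric, OF int w2]) measurable
  also have "\<dots> = expectation (\<lambda>\<omega>. 0)"
    using cond_exp_noise_square[of k] by (intro integral_cong_AE) auto
  finally have "expectation (\<lambda>\<omega>. (w k \<omega>)\<^sup>2 * (noise k \<omega>)\<^sup>2) = expectation (\<lambda>\<omega>. (w k \<omega>)\<^sup>2 * ?v \<omega>)"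
    unfolding dist Bochner_Integration.integral_diff[OF int1 int2] by simp
  also have "\<dots> \<le> expectation (\<lambda>\<omega>. (1 + \<sigma>2) * ((x k \<omega>)\<^sup>2 / (D k \<omega> * sqrt (D k \<omega>))))"
  proof (rule integral_mono[OF int2])
    show "integrable M (\<lambda>\<omega>. (1 + \<sigma>2) * ((x k \<omega>)\<^sup>2 / (D k \<omega> * sqrt (D k \<omega>))))"
      by (intro integrable_mult_right integrable_normalized_square)
    show "(w k \<omega>)\<^sup>2 * ?v \<omega> \<le> (1 + \<sigma>2) * ((x k \<omega>)\<^sup>2 / (D k \<omega> * sqrt (D k \<omega>)))" for \<omega>
    proof (cases "Suc k = s")
      \<comment> \<open>Off the outlier \<open>x k\<close> is \<open>Y k\<close>, hence bounded by
        \<open>r\<close>. At the outlier this identity fails, but the weight is 0 and so are both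
        sides.\<close>
      case False
      define r where "r = sqrt (D k \<omega>)"
      have r: "1 \<le> r" "D k \<omega> = r\<^sup>2" "real (Y k \<omega>) \<le> r"
        using D_ge_1[of k \<omega>] x_le_sqrt_D[of k \<omega>] False by (auto simp: r_def x_def)
      have "\<alpha> * (1 - \<alpha>) \<le> 1"
        using \<alpha> by (intro mult_le_one) auto
      then have "\<alpha> * (1 - \<alpha>) * real (Y k \<omega>) \<le> real (Y k \<omega>)"
        using \<alpha> by (intro mult_left_le_one_le) auto
      moreover have "\<sigma>2 * 1 \<le> \<sigma>2 * r"
        using r(1) \<sigma>2_nonneg by (intro mult_left_mono)
      \<comment> \<open>The 1 comes from \<open>\<alpha> * (1 - \<alpha>) \<le> 1\<close> and the
        \<open>\<sigma>2\<close> from \<open>1 \<le> r\<close>.\<close>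
      ultimately have "?v \<omega> \<le> (1 + \<sigma>2) * r"
        using r(3) by (simp add: algebra_simps)
      then have "(w k \<omega>)\<^sup>2 * ?v \<omega> \<le> (w k \<omega>)\<^sup>2 * ((1 + \<sigma>2) * r)"
        by (intro mult_left_mono) auto
      also have "\<dots> = (1 + \<sigma>2) * ((x k \<omega>)\<^sup>2 / (D k \<omega> * r))"
        using r(1) by (simp add: w_def r(2) power_divide field_simps power2_eq_square)
      finally show ?thesis by (simp add: r_def)
    qed (simp add: w_def x_def)
  qed
  also have "\<dots> = (1 + \<sigma>2) * expectation (\<lambda>\<omega>. (x k \<omega>)\<^sup>2 / (D k \<omega> * sqrt (D k \<omega>)))"
    by (rule integral_mult_right_zero)
  finally show ?thesis
    by (simp add: power_mult_distrib)
qed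

lemma summable_expectation_square:
  "summable (\<lambda>k. expectation (\<lambda>\<omega>. (w k \<omega> * noise k \<omega>)\<^sup>2))"
proof (rule summableI_nonneg_bounded)
  fix n
  let ?q = "\<lambda>k \<omega>. (x k \<omega>)\<^sup>2 / (D k \<omega> * sqrt (D k \<omega>))"
  have le: "(\<Sum>k<m. ?q k \<omega>) \<le> 2" for m \<omega>
    using Abel_Dini_three_halves[of "\<lambda>k. (x k \<omega>)\<^sup>2" m] by (simp add: D_def)
  note int = integrable_normalized_square
  have "(\<Sum>k<n. expectation (\<lambda>\<omega>. (w k \<omega> * noise k \<omega>)\<^sup>2)) \<le> (\<Sum>k<n. (1 + \<sigma>2) * expectation (?q k))"
    by (intro sum_mono expectation_weighted_noise_square)
  also have "\<dots> = (1 + \<sigma>2) * expectation (\<lambda>\<omega>. \<Sum>k<n. ?q k \<omega>)"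
    using int by (simp add: sum_distrib_left)
  also have "\<dots> \<le> (1 + \<sigma>2) * expectation (\<lambda>\<omega>. 2)"
    using int le \<sigma>2_nonneg by (intro mult_left_mono integral_mono) auto
  finally show "(\<Sum>k<n. expectation (\<lambda>\<omega>. (w k \<omega> * noise k \<omega>)\<^sup>2)) \<le> (1 + \<sigma>2) * 2"
    by (simp add: prob_space)
qed simp

section \<open>Divergence of the normalization and consistency\<close>

lemma AE_eps_frequently: "AE \<omega> in M. \<forall>n. \<exists>k>n. Z (IEps k) \<omega> \<noteq> 0"
proof -
  have Z_meas [measurable]: "Z (IEps i) \<in> measurable M (count_space UNIV)" if "1 \<le> i" for i
    using that by (intro measurable_Z) (auto simp: idx_def)
  define q where "q = prob {\<omega>\<in>space M. Z (IEps 1) \<omega> = 0}"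
  have "q = 1 - prob {\<omega>\<in>space M. Z (IEps 1) \<omega> \<noteq> 0}"
    unfolding q_def by (subst prob_compl[symmetric]) (auto intro!: arg_cong[where f=prob])
  then have q: "0 \<le> q" "q < 1"
    using eps_nz by (auto simp: q_def)
  have "AE \<omega> in M. \<exists>k>n. Z (IEps k) \<omega> \<noteq> 0" for n
  proof -
    let ?E = "{\<omega>\<in>space M. \<forall>k\<in>{n<..}. Z (IEps k) \<omega> = 0}"
    have "?E = (\<Inter>m. {\<omega>\<in>space M. Z (IEps (Suc (n + m))) \<omega> = 0})"
      by (auto dest!: less_imp_Suc_add)
    then have E_sets: "?E \<in> events"
      by simp
    \<comment> \<open>Vanishing of all innovations after \<open>n\<close> forces any
      \<open>Suc m\<close> consecutive ones to vanish; independence bounds this by a power of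
      \<open>q < 1\<close>.\<close>
    have bound: "prob ?E \<le> q ^ Suc m" for m
    proof -
      let ?J = "IEps ` {n<..n + Suc m}"
      have "?E \<subseteq> (\<Inter>i\<in>?J. Z i -` {0} \<inter> space M)"
        by auto
      moreover have "(\<Inter>i\<in>?J. Z i -` {0} \<inter> space M) \<in> events"
        by (intro sets.finite_INT) (auto intro!: measurable_sets[OF Z_meas])
      ultimately have "prob ?E \<le> prob (\<Inter>i\<in>?J. Z i -` {0} \<inter> space M)"
        by (rule finite_measure_mono)
      also have "\<dots> = (\<Prod>i\<in>?J. prob (Z i -` {0} \<inter> space M))"
        by (rule indep_varsD[OF indep]) auto
      also have "\<dots> = (\<Prod>k\<in>{n<..n + Suc m}. prob (Z (IEps k) -` {0} \<inter> space M))"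
        by (simp add: prod.reindex inj_on_def)
      also have "\<dots> = (\<Prod>k\<in>{n<..n + Suc m}. q)"
      proof (intro prod.cong refl)
        fix k assume "k \<in> {n<..n + Suc m}"
        then have "1 \<le> k" by auto
        have "Z (IEps k) -` {0} \<inter> space M = {\<omega>\<in>space M. Z (IEps k) \<omega> = 0}" by auto
        then show "prob (Z (IEps k) -` {0} \<inter> space M) = q"
          using prob_eps_eq_0[OF \<open>1 \<le> k\<close>] by (simp add: q_def)
      qed
      finally show ?thesis by simp
    qed
    have "prob ?E \<le> 0"
      by (rule LIMSEQ_le_const[OF LIMSEQ_Suc[OF LIMSEQ_power_zero[of q]]]) (use q bound in auto)
    then have "prob ?E = 0"
      using measure_nonneg[of M ?E] by linarith
    then have "AE \<omega> in M. \<omega> \<notin> ?E"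
      using E_sets by (simp only: prob_eq_0)
    then show ?thesis
      using AE_space by eventually_elim auto
  qed
  then show ?thesis by (simp add: AE_all_countable)
qed

lemma D_at_top:
  assumes "\<forall>n. \<exists>k>n. Z (IEps k) \<omega> \<noteq> 0"
  shows "filterlim (\<lambda>n. D n \<omega>) at_top sequentially"
  unfolding D_def
proof (rule tendsto_at_top_of_frequently_ge_1)
  fix n
  \<comment> \<open>Going beyond \<open>s\<close> ensures \<open>Suc k \<noteq> s\<close>, so that
    \<open>x k\<close> is the actual value \<open>Y k\<close>, which a nonzero innovation makes at
    least 1.\<close>
  obtain k where k: "k > n + s + 1" "Z (IEps k) \<omega> \<noteq> 0"
    using assms by blast
  have "Z (IEps k) \<omega> \<le> Y k \<omega>"
    using k(1) by (cases k) (auto simp: inarY.simps(2))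
  then have "1 \<le> x k \<omega>"
    using k by (auto simp: x_def)
  then show "\<exists>k>n. 1 \<le> (x k \<omega>)\<^sup>2"
    using k(1) by (intro exI[of _ k]) auto
qed simp

lemma sum_Y_square:
  "(\<Sum>k\<in>{1..Suc n} - {s}. (real (Y (k - 1) \<omega>))\<^sup>2) = D n \<omega> - 1"
  unfolding sum_omit_shift by (auto simp: D_def x_def intro!: sum.cong)

text \<open>Inserting the regression equation splits the numerator of the estimator into
  \<open>\<alpha>\<close> times its denominator and the weighted noise; \<open>\<theta>\<close>
  drops out with the omitted index.\<close>

lemma sum_Y_mult:
  "(\<Sum>k\<in>{1..Suc n} - {s}. (real (Y k \<omega>) - \<mu>) * real (Y (k - 1) \<omega>))
    = \<alpha> * (D n \<omega> - 1) + (\<Sum>k\<le>n. x k \<omega> * noise k \<omega>)"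
proof -
  have "(\<Sum>k\<in>{1..Suc n} - {s}. (real (Y k \<omega>) - \<mu>) * real (Y (k - 1) \<omega>))
      = (\<Sum>k\<le>n. \<alpha> * (x k \<omega>)\<^sup>2 + x k \<omega> * noise k \<omega>)"
    unfolding sum_omit_shift
    by (intro sum.cong refl) (simp add: x_def Y_Suc algebra_simps power2_eq_square)
  then show ?thesis
    by (simp add: D_def sum.distrib sum_distrib_left)
qed

lemma AE_positive_and_limit:
  defines "y \<equiv> \<lambda>\<omega> k. real (Y k \<omega>)"
  shows "AE \<omega> in M. (\<exists>n0\<ge>s. \<forall>n\<ge>n0. 0 < (\<Sum>k\<in>{1..n} - {s}. (y \<omega> (k - 1))\<^sup>2))
    \<and> (\<lambda>n. alpha_tilde \<mu> s n (y \<omega>)) \<longlonglongrightarrow> \<alpha>"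
proof -
  have "AE \<omega> in M. summable (\<lambda>k. w k \<omega> * noise k \<omega>)"
    using square_integrable_martingale_diff.AE_summable[OF martingale_diff summable_expectation_square] .
  with AE_eps_frequently show ?thesis
  proof eventually_elim
    case (elim \<omega>)
    note top = D_at_top[OF elim(1)]
    have pos: "eventually (\<lambda>n. 1 < D n \<omega>) sequentially"
      using top by (simp add: filterlim_at_top_dense)
    then obtain N where N: "\<And>n. N \<le> n \<Longrightarrow> 1 < D n \<omega>"
      by (auto simp: eventually_sequentially)
    \<comment> \<open>The sum over \<open>{1..n}\<close> corresponds to \<open>D (n - 1)\<close>,
      hence the successor.\<close>
    have "0 < (\<Sum>k\<in>{1..n} - {s}. (y \<omega> (k - 1))\<^sup>2)" if "Suc (max N s) \<le> n" for n
      using that N[of "n - 1"] sum_Y_square[where n="n - 1" and \<omega>=\<omega>] by (cases n) (auto simp: y_def)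
    then have ex: "\<exists>n0\<ge>s. \<forall>n\<ge>n0. 0 < (\<Sum>k\<in>{1..n} - {s}. (y \<omega> (k - 1))\<^sup>2)"
      by (intro exI[of _ "Suc (max N s)"]) auto
    have mono: "incseq (\<lambda>n. D n \<omega>)"
      by (intro incseq_SucI) (simp add: D_def)
    have "(\<lambda>n. (\<Sum>k\<le>n. x k \<omega> * noise k \<omega>) / D n \<omega>) \<longlonglongrightarrow> 0"
    proof (rule Kronecker_lemma[OF mono top])
      show "0 < D n \<omega>" for n
        using D_ge_1[of n \<omega>] by linarith
      show "summable (\<lambda>k. x k \<omega> * noise k \<omega> / D k \<omega>)"
        using elim(2) by (simp add: w_def)
    qed
    moreover have "(\<lambda>n. 1 / D n \<omega>) \<longlonglongrightarrow> 0"
      by (intro tendsto_divide_0[OF tendsto_const] filterlim_at_top_imp_at_infinity top)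
    \<comment> \<open>Kronecker's lemma normalizes by \<open>D n\<close>, the estimator by
      \<open>D n - 1\<close>; the factor \<open>1 - 1 / D n\<close> converts one into the
      other.\<close>
    ultimately have "(\<lambda>n. \<alpha> + (\<Sum>k\<le>n. x k \<omega> * noise k \<omega>) / D n \<omega> / (1 - 1 / D n \<omega>)) \<longlonglongrightarrow> \<alpha> + 0 / (1 - 0)"
      by (intro tendsto_intros) auto
    then have "(\<lambda>n. \<alpha> + (\<Sum>k\<le>n. x k \<omega> * noise k \<omega>) / D n \<omega> / (1 - 1 / D n \<omega>)) \<longlonglongrightarrow> \<alpha>"
      by simp
    moreover have "eventually (\<lambda>n. \<alpha> + (\<Sum>k\<le>n. x k \<omega> * noise k \<omega>) / D n \<omega> / (1 - 1 / D n \<omega>)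
        = alpha_tilde \<mu> s (Suc n) (y \<omega>)) sequentially"
      using pos
    proof eventually_elim
      case (elim n)
      then show ?case
        unfolding alpha_tilde_def y_def sum_Y_square sum_Y_mult
        by (simp add: field_simps)
    qed
    ultimately have "(\<lambda>n. alpha_tilde \<mu> s (Suc n) (y \<omega>)) \<longlonglongrightarrow> \<alpha>"
      by (rule Lim_transform_eventually)
    then show ?case
      using ex LIMSEQ_imp_Suc[of "\<lambda>n. alpha_tilde \<mu> s n (y \<omega>)"] by blast
  qed
qed

lemma AE_eventually_unique_minimum:
  defines "y \<equiv> \<lambda>\<omega> k. real (Y k \<omega>)"
  shows "AE \<omega> in M. \<exists>n0\<ge>s. \<forall>n\<ge>n0. \<forall>a t.
      (a, t) \<noteq> (alpha_tilde \<mu> s n (y \<omega>), theta_tilde \<mu> s n (y \<omega>)) \<longrightarrow>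
      Qn \<mu> s n (y \<omega>) (alpha_tilde \<mu> s n (y \<omega>)) (theta_tilde \<mu> s n (y \<omega>)) < Qn \<mu> s n (y \<omega>) a t"
  using AE_positive_and_limit
proof eventually_elim
  case (elim \<omega>)
  then obtain n0 where n0: "s \<le> n0"
    "\<And>n. n0 \<le> n \<Longrightarrow> 0 < (\<Sum>k\<in>{1..n} - {s}. (y \<omega> (k - 1))\<^sup>2)"
    unfolding y_def by blast
  show ?case
    by (intro exI[of _ n0] conjI allI impI Qn_unique_minimum n0)
qed

text \<open>For a fixed path \<open>theta_tilde\<close> is an affine function of
  \<open>alpha_tilde\<close> whose coefficients do not depend on \<open>n\<close>, so it inherits
  the convergence.\<close>

lemma AE_consistent:
  defines "y \<equiv> \<lambda>\<omega> k. real (Y k \<omega>)"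
  shows "AE \<omega> in M. (\<lambda>n. alpha_tilde \<mu> s n (y \<omega>)) \<longlonglongrightarrow> \<alpha>
      \<and> (\<lambda>n. theta_tilde \<mu> s n (y \<omega>)) \<longlonglongrightarrow> y \<omega> s - \<alpha> * y \<omega> (s - 1) - \<mu>"
  using AE_positive_and_limit
  by eventually_elim (auto simp: y_def theta_tilde_def intro!: tendsto_intros)

end

theorem theorem4p2p1:
  fixes M :: "'a measure" and Z :: "inar_idx \<Rightarrow> 'a \<Rightarrow> nat"
    and \<alpha> :: real and s \<theta> :: nat
  assumes "prob_space M"
    and \<alpha>: "0 < \<alpha>" "\<alpha> < 1"
    and s: "1 \<le> s" and \<theta>: "1 \<le> \<theta>"
    and indep: "prob_space.indep_vars M (\<lambda>_. count_space UNIV) Z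
        ({IY0} \<union> {IEps k |k. 1 \<le> k} \<union> {IXi k j |k j. 1 \<le> k \<and> 1 \<le> j})"
    and eps_iid: "\<And>k. 1 \<le> k \<Longrightarrow>
        distr M (count_space UNIV) (Z (IEps k)) = distr M (count_space UNIV) (Z (IEps 1))"
    and eps_sq: "integrable M (\<lambda>\<omega>. (real (Z (IEps 1) \<omega>))\<^sup>2)"
    and eps_nz: "measure M {\<omega>\<in>space M. Z (IEps 1) \<omega> \<noteq> 0} > 0"
    and xi_bern: "\<And>k j. 1 \<le> k \<Longrightarrow> 1 \<le> j \<Longrightarrow>
        distr M (count_space UNIV) (Z (IXi k j)) = measure_pmf (map_pmf of_bool (bernoulli_pmf \<alpha>))"
    and Y0_sq: "integrable M (\<lambda>\<omega>. (real (Z IY0 \<omega>))\<^sup>2)"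
  defines "\<mu> \<equiv> integral\<^sup>L M (\<lambda>\<omega>. real (Z (IEps 1) \<omega>))"
  defines "Y \<equiv> \<lambda>\<omega> k. real (inarY Z s \<theta> k \<omega>)"
  shows "(AE \<omega> in M. \<exists>n0\<ge>s. \<forall>n\<ge>n0. \<forall>a t.
            (a, t) \<noteq> (alpha_tilde \<mu> s n (Y \<omega>), theta_tilde \<mu> s n (Y \<omega>)) \<longrightarrow>
            Qn \<mu> s n (Y \<omega>) (alpha_tilde \<mu> s n (Y \<omega>)) (theta_tilde \<mu> s n (Y \<omega>))
              < Qn \<mu> s n (Y \<omega>) a t)
       \<and> (AE \<omega> in M. (\<lambda>n. alpha_tilde \<mu> s n (Y \<omega>)) \<longlonglongrightarrow> \<alpha>
            \<and> (\<lambda>n. theta_tilde \<mu> s n (Y \<omega>)) \<longlonglongrightarrow> Y \<omega> s - \<alpha> * Y \<omega> (s - 1) - \<mu>)"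
proof -
  have inar: "inar_outlier M Z \<alpha>"
    using assms by (intro inar_outlier.intro inar_outlier_axioms.intro)
  have mu: "\<mu> = inar_outlier.\<mu> M Z"
    unfolding \<mu>_def inar_outlier.\<mu>_def[OF inar] ..
  show ?thesis
    unfolding Y_def mu
    by (rule conjI[OF inar_outlier.AE_eventually_unique_minimum[OF inar] inar_outlier.AE_consistent[OF inar]])
qed

end
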